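(* A Gray-functor $F:\mathbb A\to\mathbb B$ is a cofibration if and only if its underlying sesquifunctor $U_*F:U_*\mathbb A\to U_*\mathbb B$ has the left lifting property with respect to surjective sesquifunctors. In particular, a Gray-category $\mathbb A$ is cofibrant if and only if its underlying sesquicategory $U_*\mathbb A$ is projective.
   Context: A Gray-category is a (small) category enriched in the category $\mathbf{2}\text{-}\mathbf{Cat}$ of (strict) 2-categories and (strict) 2-functors with the (pseudo) Gray tensor product; Gray-functors are the enriched functors. A Gray-functor $F:\mathbb A\to\mathbb B$ is a trivial fibration if and only if it is surjective on objects and each 2-functor $\mathbb A(A,B)\to\mathbb B(FA,FB)$ is a trivial fibration in $\mathbf{2}\text{-}\mathbf{Cat}$, where a 2-functor is a trivial fibration if it is surjective on objects and each functor between hom-categories is surjective on objects and fully faithful. A Gray-functor is a cofibration if it has the left lifting property with respect to all trivial fibrations; a Gray-category is cofibrant if the unique Gray-functor to it from the initial Gray-category is a cofibration. A sesquicategory is a category enriched in $\mathbf{Cat}$ with the "funny" tensor product; explicitly, it has the structure of a 2-category with vertical composition of 2-cells and whiskering of 2-cells by 1-cells on either side, satisfying all the 2-category axioms except the middle-four interchange law. Sesquifunctors are the enriched functors. $U_*$ is the functor from Gray-categories to sesquicategories which discards the 3-cells. A sesquifunctor $F:\mathscr A\to\mathscr B$ is surjective (a surjection) if it is surjective on objects and each functor $\mathscr A(A,B)\to\mathscr B(FA,FB)$ is a surjective equivalence (surjective on objects and fully faithful). A sesquicategory $\mathscr C$ is projective if the function $\mathbf{SesquiCat}(\mathscr C,F):\mathbf{SesquiCat}(\mathscr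 C,\mathscr A)\to\mathbf{SesquiCat}(\mathscr C,\mathscr B)$ is surjective for every surjective sesquifunctor $F:\mathscr A\to\mathscr B$, where $\mathbf{SesquiCat}$ is the category of sesquicategories and sesquifunctors.
   Formalization: "Surjective" sesquifunctors here are those surjective on objects whose hom-functors are surjective on objects and full, not fully faithful: with faithfulness the claim fails (2-cells Z/2, only identity 3-cells); small means cells lie in one arbitrary infinite universe. *)

theory Defs
  imports Main
begin

text \<open>
  The type \<open>'u\<close> of cells plays the role of the universe of small sets: a small (Gray-,
  sesqui-)category is one whose cells of every dimension are elements of \<open>'u\<close>.
  Operations are total functions whose values outside the carriers are irrelevant;
  accordingly, morphisms are compared by the relations \<open>eq_on_*\<close>, which only
  look at the cells of the source.
\<close>

section \<open>Categories and strict 2-categories\<close>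

record 'u cat =
  Obj :: "'u set"
  Arr :: "'u set"
  Dom :: "'u \<Rightarrow> 'u"
  Cod :: "'u \<Rightarrow> 'u"
  Idt :: "'u \<Rightarrow> 'u"
  Cmp :: "'u \<Rightarrow> 'u \<Rightarrow> 'u"  \<comment> \<open>\<open>Cmp C g f\<close> is \<open>g\<close> after \<open>f\<close>\<close>

locale category =
  fixes C :: "('u, 'm) cat_scheme"
  assumes dom_obj: "f \<in> Arr C \<Longrightarrow> Dom C f \<in> Obj C"
    and cod_obj: "f \<in> Arr C \<Longrightarrow> Cod C f \<in> Obj C"
    and idt_arr: "x \<in> Obj C \<Longrightarrow> Idt C x \<in> Arr C"
    and dom_idt: "x \<in> Obj C \<Longrightarrow> Dom C (Idt C x) = x"
    and cod_idt: "x \<in> Obj C \<Longrightarrow> Cod C (Idt C x) = x"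
    and cmp_arr: "\<lbrakk>f \<in> Arr C; g \<in> Arr C; Cod C f = Dom C g\<rbrakk> \<Longrightarrow> Cmp C g f \<in> Arr C"
    and dom_cmp: "\<lbrakk>f \<in> Arr C; g \<in> Arr C; Cod C f = Dom C g\<rbrakk> \<Longrightarrow> Dom C (Cmp C g f) = Dom C f"
    and cod_cmp: "\<lbrakk>f \<in> Arr C; g \<in> Arr C; Cod C f = Dom C g\<rbrakk> \<Longrightarrow> Cod C (Cmp C g f) = Cod C g"
    and cmp_idt_left: "f \<in> Arr C \<Longrightarrow> Cmp C (Idt C (Cod C f)) f = f"
    and cmp_idt_right: "f \<in> Arr C \<Longrightarrow> Cmp C f (Idt C (Dom C f)) = f"
    and cmp_assoc: "\<lbrakk>f \<in> Arr C; g \<in> Arr C; h \<in> Arr C; Cod C f = Dom C g; Cod C g = Dom C h\<rbrakk>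
      \<Longrightarrow> Cmp C h (Cmp C g f) = Cmp C (Cmp C h g) f"

record 'u twocat = "'u cat" +
  Cell :: "'u set"
  Src :: "'u \<Rightarrow> 'u"
  Tgt :: "'u \<Rightarrow> 'u"
  VIdt :: "'u \<Rightarrow> 'u"
  VCmp :: "'u \<Rightarrow> 'u \<Rightarrow> 'u"  \<comment> \<open>vertical: \<open>VCmp C \<beta> \<alpha>\<close> is \<open>\<beta>\<close> after \<open>\<alpha>\<close>\<close>
  HCmp :: "'u \<Rightarrow> 'u \<Rightarrow> 'u"  \<comment> \<open>horizontal: \<open>HCmp C \<beta> \<alpha>\<close> lies over \<open>Cmp C g f\<close>\<close>

definition vert :: "'u twocat \<Rightarrow> 'u cat" where
  "vert C = \<lparr>Obj = Arr C, Arr = Cell C, Dom = Src C, Cod = Tgt C, Idt = VIdt C, Cmp = VCmp C\<rparr>"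

definition horiz :: "'u twocat \<Rightarrow> 'u cat" where
  "horiz C = \<lparr>Obj = Obj C, Arr = Cell C, Dom = (\<lambda>\<alpha>. Dom C (Src C \<alpha>)), Cod = (\<lambda>\<alpha>. Cod C (Src C \<alpha>)),
     Idt = (\<lambda>x. VIdt C (Idt C x)), Cmp = HCmp C\<rparr>"

locale two_category = category C + vert: category "vert C" + horiz: category "horiz C"
  for C :: "'u twocat" +
  assumes dom_tgt: "\<alpha> \<in> Cell C \<Longrightarrow> Dom C (Tgt C \<alpha>) = Dom C (Src C \<alpha>)"
    and cod_tgt: "\<alpha> \<in> Cell C \<Longrightarrow> Cod C (Tgt C \<alpha>) = Cod C (Src C \<alpha>)"
    and src_hcmp: "\<lbrakk>\<alpha> \<in> Cell C; \<beta> \<in> Cell C; Cod C (Src C \<alpha>) = Dom C (Src C \<beta>)\<rbrakk>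
      \<Longrightarrow> Src C (HCmp C \<beta> \<alpha>) = Cmp C (Src C \<beta>) (Src C \<alpha>)"
    and tgt_hcmp: "\<lbrakk>\<alpha> \<in> Cell C; \<beta> \<in> Cell C; Cod C (Src C \<alpha>) = Dom C (Src C \<beta>)\<rbrakk>
      \<Longrightarrow> Tgt C (HCmp C \<beta> \<alpha>) = Cmp C (Tgt C \<beta>) (Tgt C \<alpha>)"
    and hcmp_vidt: "\<lbrakk>f \<in> Arr C; g \<in> Arr C; Cod C f = Dom C g\<rbrakk>
      \<Longrightarrow> HCmp C (VIdt C g) (VIdt C f) = VIdt C (Cmp C g f)"
    and interchange: "\<lbrakk>\<alpha> \<in> Cell C; \<alpha>' \<in> Cell C; \<beta> \<in> Cell C; \<beta>' \<in> Cell C;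
        Tgt C \<alpha> = Src C \<alpha>'; Tgt C \<beta> = Src C \<beta>'; Cod C (Src C \<alpha>) = Dom C (Src C \<beta>)\<rbrakk>
      \<Longrightarrow> HCmp C (VCmp C \<beta>' \<beta>) (VCmp C \<alpha>' \<alpha>) = VCmp C (HCmp C \<beta>' \<alpha>') (HCmp C \<beta> \<alpha>)"

definition hom_cat :: "'u twocat \<Rightarrow> 'u \<Rightarrow> 'u \<Rightarrow> 'u cat" where
  "hom_cat C x y =
    \<lparr>Obj = {f \<in> Arr C. Dom C f = x \<and> Cod C f = y},
     Arr = {\<alpha> \<in> Cell C. Dom C (Src C \<alpha>) = x \<and> Cod C (Src C \<alpha>) = y},
     Dom = Src C, Cod = Tgt C, Idt = VIdt C, Cmp = VCmp C\<rparr>"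

section \<open>Functors and 2-functors\<close>

record 'u func =
  FObj :: "'u \<Rightarrow> 'u"
  FArr :: "'u \<Rightarrow> 'u"

record 'u func2 = "'u func" +
  FCell :: "'u \<Rightarrow> 'u"

locale cat_functor = source: category C + target: category D
  for C :: "('u, 'm) cat_scheme" and D :: "('u, 'n) cat_scheme" and F :: "('u, 'k) func_scheme" +
  assumes map_obj: "x \<in> Obj C \<Longrightarrow> FObj F x \<in> Obj D"
    and map_arr: "f \<in> Arr C \<Longrightarrow> FArr F f \<in> Arr D"
    and map_dom: "f \<in> Arr C \<Longrightarrow> Dom D (FArr F f) = FObj F (Dom C f)"
    and map_cod: "f \<in> Arr C \<Longrightarrow> Cod D (FArr F f) = FObj F (Cod C f)"
    and map_idt: "x \<in> Obj C \<Longrightarrow> FArr F (Idt C x) = Idt D (FObj F x)"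
    and map_cmp: "\<lbrakk>f \<in> Arr C; g \<in> Arr C; Cod C f = Dom C g\<rbrakk>
      \<Longrightarrow> FArr F (Cmp C g f) = Cmp D (FArr F g) (FArr F f)"

locale two_functor = source: two_category C + target: two_category D + cat_functor C D F
    + vert: cat_functor "vert C" "vert D" "\<lparr>FObj = FArr F, FArr = FCell F\<rparr>"
    + horiz: cat_functor "horiz C" "horiz D" "\<lparr>FObj = FObj F, FArr = FCell F\<rparr>"
  for C D :: "'u twocat" and F :: "'u func2"

definition func_comp :: "'u func \<Rightarrow> 'u func \<Rightarrow> 'u func" where
  "func_comp G F = \<lparr>FObj = FObj G \<circ> FObj F, FArr = FArr G \<circ> FArr F\<rparr>"

definition func2_comp :: "'u func2 \<Rightarrow> 'u func2 \<Rightarrow> 'u func2" where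
  "func2_comp G F =
    \<lparr>FObj = FObj G \<circ> FObj F, FArr = FArr G \<circ> FArr F, FCell = FCell G \<circ> FCell F\<rparr>"

definition eq_on_cat :: "('u, 'm) cat_scheme \<Rightarrow> ('u, 'k) func_scheme \<Rightarrow> ('u, 'k) func_scheme \<Rightarrow> bool" where
  "eq_on_cat C F G \<longleftrightarrow> (\<forall>x\<in>Obj C. FObj F x = FObj G x) \<and> (\<forall>f\<in>Arr C. FArr F f = FArr G f)"

definition eq_on_twocat :: "'u twocat \<Rightarrow> 'u func2 \<Rightarrow> 'u func2 \<Rightarrow> bool" where
  "eq_on_twocat C F G \<longleftrightarrow> eq_on_cat C F G \<and> (\<forall>\<alpha>\<in>Cell C. FCell F \<alpha> = FCell G \<alpha>)"

definition surjective_on_objects ::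
    "('u, 'm) cat_scheme \<Rightarrow> ('u, 'n) cat_scheme \<Rightarrow> ('u, 'k) func_scheme \<Rightarrow> bool" where
  "surjective_on_objects C D F \<longleftrightarrow> FObj F ` Obj C = Obj D"

definition full ::
    "('u, 'm) cat_scheme \<Rightarrow> ('u, 'n) cat_scheme \<Rightarrow> ('u, 'k) func_scheme \<Rightarrow> bool" where
  "full C D F \<longleftrightarrow> (\<forall>x\<in>Obj C. \<forall>y\<in>Obj C. \<forall>g\<in>Arr D. Dom D g = FObj F x \<and> Cod D g = FObj F y \<longrightarrow>
     (\<exists>f\<in>Arr C. Dom C f = x \<and> Cod C f = y \<and> FArr F f = g))"

definition faithful :: "('u, 'm) cat_scheme \<Rightarrow> ('u, 'k) func_scheme \<Rightarrow> bool" where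
  "faithful C F \<longleftrightarrow> (\<forall>f\<in>Arr C. \<forall>g\<in>Arr C.
     Dom C f = Dom C g \<and> Cod C f = Cod C g \<and> FArr F f = FArr F g \<longrightarrow> f = g)"

definition two_trivial_fibration :: "'u twocat \<Rightarrow> 'u twocat \<Rightarrow> 'u func2 \<Rightarrow> bool" where
  "two_trivial_fibration C D F \<longleftrightarrow> two_functor C D F \<and> surjective_on_objects C D F \<and>
    (\<forall>x\<in>Obj C. \<forall>y\<in>Obj C.
      let Fxy = \<lparr>FObj = FArr F, FArr = FCell F\<rparr> in
      surjective_on_objects (hom_cat C x y) (hom_cat D (FObj F x) (FObj F y)) Fxy \<and>
      full (hom_cat C x y) (hom_cat D (FObj F x) (FObj F y)) Fxy \<and>
      faithful (hom_cat C x y) Fxy)"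

section \<open>Functors out of tensor products\<close>

text \<open>
  A functor \<open>A \<otimes> B \<rightarrow> C\<close> out of the funny tensor product is a pair of families of functors
  \<open>T(x, -) : B \<rightarrow> C\<close> and \<open>T(-, y) : A \<rightarrow> C\<close> that agree on objects.
  A 2-functor out of the Gray tensor product consists of such families of
  2-functors together with invertible 2-cells
  \<open>\<gamma> f g : T(f, cod g) T(dom f, g) \<Rightarrow> T(cod f, g) T(f, dom g)\<close>,
  natural in \<open>f\<close> and \<open>g\<close> and compatible with identities and composition.
  These are the generators and relations that define the two tensor products.
\<close>

record 'u bifunc =
  BObj :: "'u \<Rightarrow> 'u \<Rightarrow> 'u"
  BL :: "'u \<Rightarrow> 'u \<Rightarrow> 'u"  \<comment> \<open>arrow of \<open>A\<close>, object of \<open>B\<close>\<close>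
  BR :: "'u \<Rightarrow> 'u \<Rightarrow> 'u"  \<comment> \<open>object of \<open>A\<close>, arrow of \<open>B\<close>\<close>

record 'u gbifunc = "'u bifunc" +
  BL2 :: "'u \<Rightarrow> 'u \<Rightarrow> 'u"  \<comment> \<open>2-cell of \<open>A\<close>, object of \<open>B\<close>\<close>
  BR2 :: "'u \<Rightarrow> 'u \<Rightarrow> 'u"  \<comment> \<open>object of \<open>A\<close>, 2-cell of \<open>B\<close>\<close>
  Gam :: "'u \<Rightarrow> 'u \<Rightarrow> 'u"  \<comment> \<open>arrow of \<open>A\<close>, arrow of \<open>B\<close>\<close>

locale funny_functor = A: category A + B: category B + C: category C
  for A B C :: "'u cat" and T :: "'u bifunc" +
  assumes right: "x \<in> Obj A \<Longrightarrow> cat_functor B C \<lparr>FObj = BObj T x, FArr = BR T x\<rparr>"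
    and left: "y \<in> Obj B \<Longrightarrow> cat_functor A C \<lparr>FObj = (\<lambda>x. BObj T x y), FArr = (\<lambda>f. BL T f y)\<rparr>"

locale gray_bifunctor = A: two_category A + B: two_category B + C: two_category C
  for A B C :: "'u twocat" and T :: "'u gbifunc" +
  assumes right: "x \<in> Obj A \<Longrightarrow>
      two_functor B C \<lparr>FObj = BObj T x, FArr = BR T x, FCell = BR2 T x\<rparr>"
    and left: "y \<in> Obj B \<Longrightarrow>
      two_functor A C \<lparr>FObj = (\<lambda>x. BObj T x y), FArr = (\<lambda>f. BL T f y), FCell = (\<lambda>\<alpha>. BL2 T \<alpha> y)\<rparr>"
    and gam_cell: "\<lbrakk>f \<in> Arr A; g \<in> Arr B\<rbrakk> \<Longrightarrow> Gam T f g \<in> Cell C"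
    and src_gam: "\<lbrakk>f \<in> Arr A; g \<in> Arr B\<rbrakk>
      \<Longrightarrow> Src C (Gam T f g) = Cmp C (BL T f (Cod B g)) (BR T (Dom A f) g)"
    and tgt_gam: "\<lbrakk>f \<in> Arr A; g \<in> Arr B\<rbrakk>
      \<Longrightarrow> Tgt C (Gam T f g) = Cmp C (BR T (Cod A f) g) (BL T f (Dom B g))"
    and gam_invertible: "\<lbrakk>f \<in> Arr A; g \<in> Arr B\<rbrakk>
      \<Longrightarrow> \<exists>\<delta>\<in>Cell C. Src C \<delta> = Tgt C (Gam T f g) \<and> Tgt C \<delta> = Src C (Gam T f g) \<and>
            VCmp C \<delta> (Gam T f g) = VIdt C (Src C (Gam T f g)) \<and>
            VCmp C (Gam T f g) \<delta> = VIdt C (Tgt C (Gam T f g))"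
    and gam_idt_left: "\<lbrakk>x \<in> Obj A; g \<in> Arr B\<rbrakk> \<Longrightarrow> Gam T (Idt A x) g = VIdt C (BR T x g)"
    and gam_idt_right: "\<lbrakk>f \<in> Arr A; y \<in> Obj B\<rbrakk> \<Longrightarrow> Gam T f (Idt B y) = VIdt C (BL T f y)"
    and gam_cmp_left: "\<lbrakk>f \<in> Arr A; f' \<in> Arr A; Cod A f = Dom A f'; g \<in> Arr B\<rbrakk>
      \<Longrightarrow> Gam T (Cmp A f' f) g =
        VCmp C (HCmp C (Gam T f' g) (VIdt C (BL T f (Dom B g))))
               (HCmp C (VIdt C (BL T f' (Cod B g))) (Gam T f g))"
    and gam_cmp_right: "\<lbrakk>f \<in> Arr A; g \<in> Arr B; g' \<in> Arr B; Cod B g = Dom B g'\<rbrakk>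
      \<Longrightarrow> Gam T f (Cmp B g' g) =
        VCmp C (HCmp C (VIdt C (BR T (Cod A f) g')) (Gam T f g))
               (HCmp C (Gam T f g') (VIdt C (BR T (Dom A f) g)))"
    and gam_natural: "\<lbrakk>\<phi> \<in> Cell A; \<psi> \<in> Cell B\<rbrakk>
      \<Longrightarrow> VCmp C (Gam T (Tgt A \<phi>) (Tgt B \<psi>))
               (HCmp C (BL2 T \<phi> (Cod B (Src B \<psi>))) (BR2 T (Dom A (Src A \<phi>)) \<psi>)) =
          VCmp C (HCmp C (BR2 T (Cod A (Src A \<phi>)) \<psi>) (BL2 T \<phi> (Dom B (Src B \<psi>))))
               (Gam T (Src A \<phi>) (Src B \<psi>))"

section \<open>Sesquicategories and Gray-categories\<close>

text \<open>
  Data of an enriched category, respectively an enriched functor: \<open>'h\<close> is the type of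
  hom-objects, \<open>'t\<close> the type of composition maps
  \<open>EComp A a b c : EHom A b c \<otimes> EHom A a b \<rightarrow> EHom A a c\<close>, and \<open>'f\<close> the type of maps between
  hom-objects. Thus the \<open>n\<close>-cells of a hom-object are \<open>(n+1)\<close>-cells.
\<close>

record ('u, 'h, 't) enriched =
  EOb :: "'u set"
  EHom :: "'u \<Rightarrow> 'u \<Rightarrow> 'h"
  EUnit :: "'u \<Rightarrow> 'u"
  EComp :: "'u \<Rightarrow> 'u \<Rightarrow> 'u \<Rightarrow> 't"

record ('u, 'f) enriched_fun =
  EFOb :: "'u \<Rightarrow> 'u"
  EFHom :: "'u \<Rightarrow> 'u \<Rightarrow> 'f"

type_synonym 'u sesqui = "('u, 'u cat, 'u bifunc) enriched"
type_synonym 'u gray = "('u, 'u twocat, 'u gbifunc) enriched"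
type_synonym 'u sesqui_fun = "('u, 'u func) enriched_fun"
type_synonym 'u gray_fun = "('u, 'u func2) enriched_fun"

locale sesquicategory =
  fixes A :: "'u sesqui"
  assumes hom_category: "\<lbrakk>a \<in> EOb A; b \<in> EOb A\<rbrakk> \<Longrightarrow> category (EHom A a b)"
    and unit_obj: "a \<in> EOb A \<Longrightarrow> EUnit A a \<in> Obj (EHom A a a)"
    and comp_functor: "\<lbrakk>a \<in> EOb A; b \<in> EOb A; c \<in> EOb A\<rbrakk>
      \<Longrightarrow> funny_functor (EHom A b c) (EHom A a b) (EHom A a c) (EComp A a b c)"
    and assoc_obj: "\<lbrakk>a \<in> EOb A; b \<in> EOb A; c \<in> EOb A; d \<in> EOb A;
        f \<in> Obj (EHom A a b); g \<in> Obj (EHom A b c); h \<in> Obj (EHom A c d)\<rbrakk>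
      \<Longrightarrow> BObj (EComp A a b d) (BObj (EComp A b c d) h g) f =
          BObj (EComp A a c d) h (BObj (EComp A a b c) g f)"
    and assoc_arr_left: "\<lbrakk>a \<in> EOb A; b \<in> EOb A; c \<in> EOb A; d \<in> EOb A;
        f \<in> Obj (EHom A a b); g \<in> Obj (EHom A b c); \<phi> \<in> Arr (EHom A c d)\<rbrakk>
      \<Longrightarrow> BL (EComp A a b d) (BL (EComp A b c d) \<phi> g) f =
          BL (EComp A a c d) \<phi> (BObj (EComp A a b c) g f)"
    and assoc_arr_mid: "\<lbrakk>a \<in> EOb A; b \<in> EOb A; c \<in> EOb A; d \<in> EOb A;
        f \<in> Obj (EHom A a b); \<psi> \<in> Arr (EHom A b c); h \<in> Obj (EHom A c d)\<rbrakk>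
      \<Longrightarrow> BL (EComp A a b d) (BR (EComp A b c d) h \<psi>) f =
          BR (EComp A a c d) h (BL (EComp A a b c) \<psi> f)"
    and assoc_arr_right: "\<lbrakk>a \<in> EOb A; b \<in> EOb A; c \<in> EOb A; d \<in> EOb A;
        \<chi> \<in> Arr (EHom A a b); g \<in> Obj (EHom A b c); h \<in> Obj (EHom A c d)\<rbrakk>
      \<Longrightarrow> BR (EComp A a b d) (BObj (EComp A b c d) h g) \<chi> =
          BR (EComp A a c d) h (BR (EComp A a b c) g \<chi>)"
    and unit_left_obj: "\<lbrakk>a \<in> EOb A; b \<in> EOb A; f \<in> Obj (EHom A a b)\<rbrakk>
      \<Longrightarrow> BObj (EComp A a b b) (EUnit A b) f = f"
    and unit_right_obj: "\<lbrakk>a \<in> EOb A; b \<in> EOb A; f \<in> Obj (EHom A a b)\<rbrakk>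
      \<Longrightarrow> BObj (EComp A a a b) f (EUnit A a) = f"
    and unit_left_arr: "\<lbrakk>a \<in> EOb A; b \<in> EOb A; \<phi> \<in> Arr (EHom A a b)\<rbrakk>
      \<Longrightarrow> BR (EComp A a b b) (EUnit A b) \<phi> = \<phi>"
    and unit_right_arr: "\<lbrakk>a \<in> EOb A; b \<in> EOb A; \<phi> \<in> Arr (EHom A a b)\<rbrakk>
      \<Longrightarrow> BL (EComp A a a b) \<phi> (EUnit A a) = \<phi>"

definition U_star :: "'u gray \<Rightarrow> 'u sesqui" where
  "U_star A = \<lparr>EOb = EOb A, EHom = (\<lambda>a b. cat.truncate (EHom A a b)), EUnit = EUnit A,
     EComp = (\<lambda>a b c. bifunc.truncate (EComp A a b c))\<rparr>"

definition U_star_fun :: "'u gray_fun \<Rightarrow> 'u sesqui_fun" where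
  "U_star_fun F = \<lparr>EFOb = EFOb F, EFHom = (\<lambda>a b. func.truncate (EFHom F a b))\<rparr>"

text \<open>
  The equations of a Gray-category between cells of dimension at most 2 are those of a
  sesquicategory, so they are inherited from \<open>U_star A\<close>; what remains is associativity on the
  2-cells of the homs and on the interchangers \<open>\<gamma>\<close> (one equation for each way of choosing
  two of the three variables), and the unit laws on the 2-cells of the homs.
\<close>

locale gray_category = sesquicategory "U_star A" for A :: "'u gray" +
  assumes hom_two_category: "\<lbrakk>a \<in> EOb A; b \<in> EOb A\<rbrakk> \<Longrightarrow> two_category (EHom A a b)"
    and comp_gray_bifunctor: "\<lbrakk>a \<in> EOb A; b \<in> EOb A; c \<in> EOb A\<rbrakk>
      \<Longrightarrow> gray_bifunctor (EHom A b c) (EHom A a b) (EHom A a c) (EComp A a b c)"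
    and assoc_cell_left: "\<lbrakk>a \<in> EOb A; b \<in> EOb A; c \<in> EOb A; d \<in> EOb A;
        f \<in> Obj (EHom A a b); g \<in> Obj (EHom A b c); \<phi> \<in> Cell (EHom A c d)\<rbrakk>
      \<Longrightarrow> BL2 (EComp A a b d) (BL2 (EComp A b c d) \<phi> g) f =
          BL2 (EComp A a c d) \<phi> (BObj (EComp A a b c) g f)"
    and assoc_cell_mid: "\<lbrakk>a \<in> EOb A; b \<in> EOb A; c \<in> EOb A; d \<in> EOb A;
        f \<in> Obj (EHom A a b); \<psi> \<in> Cell (EHom A b c); h \<in> Obj (EHom A c d)\<rbrakk>
      \<Longrightarrow> BL2 (EComp A a b d) (BR2 (EComp A b c d) h \<psi>) f =
          BR2 (EComp A a c d) h (BL2 (EComp A a b c) \<psi> f)"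
    and assoc_cell_right: "\<lbrakk>a \<in> EOb A; b \<in> EOb A; c \<in> EOb A; d \<in> EOb A;
        \<chi> \<in> Cell (EHom A a b); g \<in> Obj (EHom A b c); h \<in> Obj (EHom A c d)\<rbrakk>
      \<Longrightarrow> BR2 (EComp A a b d) (BObj (EComp A b c d) h g) \<chi> =
          BR2 (EComp A a c d) h (BR2 (EComp A a b c) g \<chi>)"
    and assoc_gam_left_mid: "\<lbrakk>a \<in> EOb A; b \<in> EOb A; c \<in> EOb A; d \<in> EOb A;
        f \<in> Obj (EHom A a b); \<psi> \<in> Arr (EHom A b c); \<phi> \<in> Arr (EHom A c d)\<rbrakk>
      \<Longrightarrow> BL2 (EComp A a b d) (Gam (EComp A b c d) \<phi> \<psi>) f =
          Gam (EComp A a c d) \<phi> (BL (EComp A a b c) \<psi> f)"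
    and assoc_gam_left_right: "\<lbrakk>a \<in> EOb A; b \<in> EOb A; c \<in> EOb A; d \<in> EOb A;
        \<chi> \<in> Arr (EHom A a b); g \<in> Obj (EHom A b c); \<phi> \<in> Arr (EHom A c d)\<rbrakk>
      \<Longrightarrow> Gam (EComp A a b d) (BL (EComp A b c d) \<phi> g) \<chi> =
          Gam (EComp A a c d) \<phi> (BR (EComp A a b c) g \<chi>)"
    and assoc_gam_mid_right: "\<lbrakk>a \<in> EOb A; b \<in> EOb A; c \<in> EOb A; d \<in> EOb A;
        \<chi> \<in> Arr (EHom A a b); \<psi> \<in> Arr (EHom A b c); h \<in> Obj (EHom A c d)\<rbrakk>
      \<Longrightarrow> Gam (EComp A a b d) (BR (EComp A b c d) h \<psi>) \<chi> =
          BR2 (EComp A a c d) h (Gam (EComp A a b c) \<psi> \<chi>)"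
    and unit_left_cell: "\<lbrakk>a \<in> EOb A; b \<in> EOb A; \<phi> \<in> Cell (EHom A a b)\<rbrakk>
      \<Longrightarrow> BR2 (EComp A a b b) (EUnit A b) \<phi> = \<phi>"
    and unit_right_cell: "\<lbrakk>a \<in> EOb A; b \<in> EOb A; \<phi> \<in> Cell (EHom A a b)\<rbrakk>
      \<Longrightarrow> BL2 (EComp A a a b) \<phi> (EUnit A a) = \<phi>"

section \<open>Sesquifunctors and Gray-functors\<close>

locale sesquifunctor = source: sesquicategory A + target: sesquicategory B
  for A B :: "'u sesqui" and F :: "'u sesqui_fun" +
  assumes map_ob: "a \<in> EOb A \<Longrightarrow> EFOb F a \<in> EOb B"
    and map_hom: "\<lbrakk>a \<in> EOb A; b \<in> EOb A\<rbrakk>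
      \<Longrightarrow> cat_functor (EHom A a b) (EHom B (EFOb F a) (EFOb F b)) (EFHom F a b)"
    and map_unit: "a \<in> EOb A \<Longrightarrow> FObj (EFHom F a a) (EUnit A a) = EUnit B (EFOb F a)"
    and map_comp_obj: "\<lbrakk>a \<in> EOb A; b \<in> EOb A; c \<in> EOb A; f \<in> Obj (EHom A a b); g \<in> Obj (EHom A b c)\<rbrakk>
      \<Longrightarrow> FObj (EFHom F a c) (BObj (EComp A a b c) g f) =
          BObj (EComp B (EFOb F a) (EFOb F b) (EFOb F c)) (FObj (EFHom F b c) g) (FObj (EFHom F a b) f)"
    and map_comp_left: "\<lbrakk>a \<in> EOb A; b \<in> EOb A; c \<in> EOb A; f \<in> Obj (EHom A a b); \<psi> \<in> Arr (EHom A b c)\<rbrakk>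
      \<Longrightarrow> FArr (EFHom F a c) (BL (EComp A a b c) \<psi> f) =
          BL (EComp B (EFOb F a) (EFOb F b) (EFOb F c)) (FArr (EFHom F b c) \<psi>) (FObj (EFHom F a b) f)"
    and map_comp_right: "\<lbrakk>a \<in> EOb A; b \<in> EOb A; c \<in> EOb A; \<phi> \<in> Arr (EHom A a b); g \<in> Obj (EHom A b c)\<rbrakk>
      \<Longrightarrow> FArr (EFHom F a c) (BR (EComp A a b c) g \<phi>) =
          BR (EComp B (EFOb F a) (EFOb F b) (EFOb F c)) (FObj (EFHom F b c) g) (FArr (EFHom F a b) \<phi>)"

locale gray_functor = source: gray_category A + target: gray_category B
    + sesquifunctor "U_star A" "U_star B" "U_star_fun F"
  for A B :: "'u gray" and F :: "'u gray_fun" +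
  assumes map_two_hom: "\<lbrakk>a \<in> EOb A; b \<in> EOb A\<rbrakk>
      \<Longrightarrow> two_functor (EHom A a b) (EHom B (EFOb F a) (EFOb F b)) (EFHom F a b)"
    and map_comp_left_cell: "\<lbrakk>a \<in> EOb A; b \<in> EOb A; c \<in> EOb A; f \<in> Obj (EHom A a b); \<psi> \<in> Cell (EHom A b c)\<rbrakk>
      \<Longrightarrow> FCell (EFHom F a c) (BL2 (EComp A a b c) \<psi> f) =
          BL2 (EComp B (EFOb F a) (EFOb F b) (EFOb F c)) (FCell (EFHom F b c) \<psi>) (FObj (EFHom F a b) f)"
    and map_comp_right_cell: "\<lbrakk>a \<in> EOb A; b \<in> EOb A; c \<in> EOb A; \<phi> \<in> Cell (EHom A a b); g \<in> Obj (EHom A b c)\<rbrakk>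
      \<Longrightarrow> FCell (EFHom F a c) (BR2 (EComp A a b c) g \<phi>) =
          BR2 (EComp B (EFOb F a) (EFOb F b) (EFOb F c)) (FObj (EFHom F b c) g) (FCell (EFHom F a b) \<phi>)"
    and map_gam: "\<lbrakk>a \<in> EOb A; b \<in> EOb A; c \<in> EOb A; \<phi> \<in> Arr (EHom A a b); \<psi> \<in> Arr (EHom A b c)\<rbrakk>
      \<Longrightarrow> FCell (EFHom F a c) (Gam (EComp A a b c) \<psi> \<phi>) =
          Gam (EComp B (EFOb F a) (EFOb F b) (EFOb F c)) (FArr (EFHom F b c) \<psi>) (FArr (EFHom F a b) \<phi>)"

definition sesqui_comp :: "'u sesqui_fun \<Rightarrow> 'u sesqui_fun \<Rightarrow> 'u sesqui_fun" where
  "sesqui_comp G F = \<lparr>EFOb = EFOb G \<circ> EFOb F,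
     EFHom = (\<lambda>a b. func_comp (EFHom G (EFOb F a) (EFOb F b)) (EFHom F a b))\<rparr>"

definition gray_comp :: "'u gray_fun \<Rightarrow> 'u gray_fun \<Rightarrow> 'u gray_fun" where
  "gray_comp G F = \<lparr>EFOb = EFOb G \<circ> EFOb F,
     EFHom = (\<lambda>a b. func2_comp (EFHom G (EFOb F a) (EFOb F b)) (EFHom F a b))\<rparr>"

definition eq_on_sesqui :: "'u sesqui \<Rightarrow> 'u sesqui_fun \<Rightarrow> 'u sesqui_fun \<Rightarrow> bool" where
  "eq_on_sesqui A F G \<longleftrightarrow> (\<forall>a\<in>EOb A. EFOb F a = EFOb G a) \<and>
     (\<forall>a\<in>EOb A. \<forall>b\<in>EOb A. eq_on_cat (EHom A a b) (EFHom F a b) (EFHom G a b))"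

definition eq_on_gray :: "'u gray \<Rightarrow> 'u gray_fun \<Rightarrow> 'u gray_fun \<Rightarrow> bool" where
  "eq_on_gray A F G \<longleftrightarrow> (\<forall>a\<in>EOb A. EFOb F a = EFOb G a) \<and>
     (\<forall>a\<in>EOb A. \<forall>b\<in>EOb A. eq_on_twocat (EHom A a b) (EFHom F a b) (EFHom G a b))"

section \<open>Trivial fibrations, cofibrations, surjections\<close>

definition gray_trivial_fibration :: "'u gray \<Rightarrow> 'u gray \<Rightarrow> 'u gray_fun \<Rightarrow> bool" where
  "gray_trivial_fibration X Y P \<longleftrightarrow> gray_functor X Y P \<and> EFOb P ` EOb X = EOb Y \<and>
    (\<forall>a\<in>EOb X. \<forall>b\<in>EOb X.
       two_trivial_fibration (EHom X a b) (EHom Y (EFOb P a) (EFOb P b)) (EFHom P a b))"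

definition gray_cofibration :: "'u gray \<Rightarrow> 'u gray \<Rightarrow> 'u gray_fun \<Rightarrow> bool" where
  "gray_cofibration A B F \<longleftrightarrow> gray_functor A B F \<and>
    (\<forall>X Y P G K. gray_trivial_fibration X Y P \<and> gray_functor A X G \<and> gray_functor B Y K \<and>
       eq_on_gray A (gray_comp P G) (gray_comp K F) \<longrightarrow>
       (\<exists>L. gray_functor B X L \<and> eq_on_gray A (gray_comp L F) G \<and> eq_on_gray B (gray_comp P L) K))"

definition gray_initial :: "'u gray" where
  "gray_initial = \<lparr>EOb = {}, EHom = undefined, EUnit = undefined, EComp = undefined\<rparr>"

definition gray_cofibrant :: "'u gray \<Rightarrow> bool" where
  "gray_cofibrant A \<longleftrightarrow> (\<exists>F. gray_functor gray_initial A F \<and> gray_cofibration gray_initial A F)"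

lemma gray_category_initial: "gray_category gray_initial"
  by unfold_locales (simp_all add: gray_initial_def U_star_def)

lemma gray_functor_from_initial:
  assumes "gray_category A"
  shows "gray_functor gray_initial A F"
proof -
  interpret I: gray_category gray_initial by (rule gray_category_initial)
  interpret A: gray_category A by (rule assms)
  show ?thesis by unfold_locales (simp_all add: gray_initial_def U_star_def)
qed

lemma gray_functor_from_initial_unique: "eq_on_gray gray_initial F G"
  by (simp add: eq_on_gray_def gray_initial_def)

text \<open>
  A surjection is surjective on cells of every dimension: surjective on objects, and on each
  hom-category surjective on objects and full. It is not required to be locally faithful;
  that is, the functors on hom-categories need not be surjective equivalences.
  With local faithfulness the lifting property would only constrain the 1-cells, and the
  characterisation of cofibrations would fail: take the Gray-category with one object, one
  1-cell, \<open>\<int>/2\<close> as its monoid of 2-cells and only identity 3-cells. Its underlying sesquicategory lifts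
  against all locally faithful surjections, but it is not cofibrant: if the 2-cells are replaced by \<open>\<nat>\<close>,
  with a unique 3-cell \<open>m \<Rightarrow> n\<close> whenever \<open>m\<close> and \<open>n\<close> have the same parity, then
  reduction mod 2 is a trivial fibration without a section. Moreover the trivial
  fibrations are precisely the Gray-functors \<open>P\<close> with \<open>U_star_fun P\<close> a
  surjection in the present sense that are bijective on 3-cells with given boundary.
\<close>

definition sesqui_surjective :: "'u sesqui \<Rightarrow> 'u sesqui \<Rightarrow> 'u sesqui_fun \<Rightarrow> bool" where
  "sesqui_surjective S T P \<longleftrightarrow> sesquifunctor S T P \<and> EFOb P ` EOb S = EOb T \<and>
    (\<forall>a\<in>EOb S. \<forall>b\<in>EOb S.
       surjective_on_objects (EHom S a b) (EHom T (EFOb P a) (EFOb P b)) (EFHom P a b) \<and>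
       full (EHom S a b) (EHom T (EFOb P a) (EFOb P b)) (EFHom P a b))"

definition sesqui_llp_surjective :: "'u sesqui \<Rightarrow> 'u sesqui \<Rightarrow> 'u sesqui_fun \<Rightarrow> bool" where
  "sesqui_llp_surjective A B F \<longleftrightarrow>
    (\<forall>S T P G K. sesqui_surjective S T P \<and> sesquifunctor A S G \<and> sesquifunctor B T K \<and>
       eq_on_sesqui A (sesqui_comp P G) (sesqui_comp K F) \<longrightarrow>
       (\<exists>L. sesquifunctor B S L \<and> eq_on_sesqui A (sesqui_comp L F) G \<and>
            eq_on_sesqui B (sesqui_comp P L) K))"

definition sesqui_projective :: "'u sesqui \<Rightarrow> bool" where
  "sesqui_projective C \<longleftrightarrow> sesquicategory C \<and>
    (\<forall>S T P K. sesqui_surjective S T P \<and> sesquifunctor C T K \<longrightarrow>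
       (\<exists>L. sesquifunctor C S L \<and> eq_on_sesqui C (sesqui_comp P L) K))"

end

theory Submission
  imports Defs
begin

text \<open>
  A Gray-functor is a trivial fibration exactly when its underlying sesquifunctor is a surjection
  and it is bijective on 3-cells with given boundary (\<open>gray_trivial_fibration_iff\<close>). The second
  condition makes 3-cells irrelevant to lifting problems: along such a \<open>P\<close>, a lift of the
  underlying sesquifunctor extends uniquely to 3-cells, since a 3-cell must go to the one 3-cell
  that has the prescribed boundary and the prescribed image under \<open>P\<close>, and every equation between
  3-cells may be checked on boundaries and after applying \<open>P\<close> (\<open>gray_functor_lift\<close>,
  \<open>eq_on_gray_if_locally_fully_faithful\<close>). Therefore the lifting property of the underlying
  sesquifunctor against surjections implies that a Gray-functor is a cofibration.

  For the converse, \<open>U_star\<close> has a right adjoint \<open>indiscrete_gray\<close>, which adds to a sesquicategory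
  exactly one 3-cell between any two parallel 2-cells; the interchangers then exist for free. It is
  a section of \<open>U_star\<close> and sends surjections to trivial fibrations
  (\<open>gray_trivial_fibration_indiscrete\<close>). A lifting problem of \<open>U_star_fun F\<close> against a surjection
  thus transposes to a lifting problem of \<open>F\<close> against a trivial fibration, and a solution of the
  latter has an underlying sesquifunctor that solves the former. A 3-cell of \<open>indiscrete_gray\<close> is a
  pair of 2-cells, which has to be coded by a single element of the universe; this is possible
  because the universe is infinite. Transposition across the adjunction is again an instance of
  \<open>gray_functor_lift\<close>: a Gray-category is indiscrete precisely when its functor to the terminal
  Gray-category is bijective on 3-cells with given boundary.

  The statement about cofibrant Gray-categories is the case where the source is initial: the
  commutative square of a lifting problem then carries no information beyond its lower edge.
\<close>

section \<open>Components of truncations and composites\<close>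

lemma truncate_cat_sel [simp]:
  "Obj (cat.truncate C) = Obj C" "Arr (cat.truncate C) = Arr C"
  "Dom (cat.truncate C) = Dom C" "Cod (cat.truncate C) = Cod C"
  "Idt (cat.truncate C) = Idt C" "Cmp (cat.truncate C) = Cmp C"
  by (simp_all add: cat.truncate_def)

lemma truncate_func_sel [simp]:
  "FObj (func.truncate F) = FObj F" "FArr (func.truncate F) = FArr F"
  by (simp_all add: func.truncate_def)

lemma truncate_bifunc_sel [simp]:
  "BObj (bifunc.truncate T) = BObj T" "BL (bifunc.truncate T) = BL T" "BR (bifunc.truncate T) = BR T"
  by (simp_all add: bifunc.truncate_def)

lemma vert_sel [simp]:
  "Obj (vert C) = Arr C" "Arr (vert C) = Cell C" "Dom (vert C) = Src C" "Cod (vert C) = Tgt C"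
  "Idt (vert C) = VIdt C" "Cmp (vert C) = VCmp C"
  by (simp_all add: vert_def)

lemma horiz_sel [simp]:
  "Obj (horiz C) = Obj C" "Arr (horiz C) = Cell C" "Dom (horiz C) \<alpha> = Dom C (Src C \<alpha>)"
  "Cod (horiz C) \<alpha> = Cod C (Src C \<alpha>)" "Idt (horiz C) x = VIdt C (Idt C x)"
  "Cmp (horiz C) = HCmp C"
  by (simp_all add: horiz_def)

lemma U_star_sel [simp]:
  "EOb (U_star A) = EOb A" "EHom (U_star A) a b = cat.truncate (EHom A a b)"
  "EUnit (U_star A) = EUnit A" "EComp (U_star A) a b c = bifunc.truncate (EComp A a b c)"
  by (simp_all add: U_star_def)

lemma U_star_fun_sel [simp]:
  "EFOb (U_star_fun F) = EFOb F" "EFHom (U_star_fun F) a b = func.truncate (EFHom F a b)"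
  by (simp_all add: U_star_fun_def)

lemma category_truncate [simp]: "category (cat.truncate C) \<longleftrightarrow> category C"
  by (simp add: category_def)

lemma cat_functor_truncate [simp]:
  "cat_functor (cat.truncate C) (cat.truncate D) (func.truncate F) \<longleftrightarrow> cat_functor C D F"
  by (simp add: cat_functor_def cat_functor_axioms_def)

lemma func_comp_sel [simp]:
  "FObj (func_comp G F) x = FObj G (FObj F x)" "FArr (func_comp G F) f = FArr G (FArr F f)"
  by (simp_all add: func_comp_def)

lemma func2_comp_sel [simp]:
  "FObj (func2_comp G F) x = FObj G (FObj F x)" "FArr (func2_comp G F) f = FArr G (FArr F f)"
  "FCell (func2_comp G F) \<alpha> = FCell G (FCell F \<alpha>)"
  by (simp_all add: func2_comp_def)

lemma sesqui_comp_sel [simp]: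
  "EFOb (sesqui_comp G F) a = EFOb G (EFOb F a)"
  "EFHom (sesqui_comp G F) a b = func_comp (EFHom G (EFOb F a) (EFOb F b)) (EFHom F a b)"
  by (simp_all add: sesqui_comp_def)

lemma gray_comp_sel [simp]:
  "EFOb (gray_comp G F) a = EFOb G (EFOb F a)"
  "EFHom (gray_comp G F) a b = func2_comp (EFHom G (EFOb F a) (EFOb F b)) (EFHom F a b)"
  by (simp_all add: gray_comp_def)

lemma eq_on_grayD:
  assumes "eq_on_gray A F G"
  shows "eq_on_sesqui (U_star A) (U_star_fun F) (U_star_fun G)"
    and "\<lbrakk>a \<in> EOb A; b \<in> EOb A; \<phi> \<in> Cell (EHom A a b)\<rbrakk>
      \<Longrightarrow> FCell (EFHom F a b) \<phi> = FCell (EFHom G a b) \<phi>"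
  using assms by (auto simp: eq_on_gray_def eq_on_twocat_def eq_on_sesqui_def eq_on_cat_def)

lemma eq_on_grayI:
  assumes "eq_on_sesqui (U_star A) (U_star_fun F) (U_star_fun G)"
    and "\<And>a b \<phi>. \<lbrakk>a \<in> EOb A; b \<in> EOb A; \<phi> \<in> Cell (EHom A a b)\<rbrakk>
      \<Longrightarrow> FCell (EFHom F a b) \<phi> = FCell (EFHom G a b) \<phi>"
  shows "eq_on_gray A F G"
  using assms by (auto simp: eq_on_gray_def eq_on_twocat_def eq_on_sesqui_def eq_on_cat_def)

lemma U_star_fun_comp: "U_star_fun (gray_comp G F) = sesqui_comp (U_star_fun G) (U_star_fun F)"
  by (simp add: U_star_fun_def gray_comp_def sesqui_comp_def func_comp_def func2_comp_def
      func.truncate_def)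

lemma eq_on_sesquiD:
  assumes "eq_on_sesqui A F G" "a \<in> EOb A" "b \<in> EOb A"
  shows "EFOb F a = EFOb G a"
    and "f \<in> Obj (EHom A a b) \<Longrightarrow> FObj (EFHom F a b) f = FObj (EFHom G a b) f"
    and "\<phi> \<in> Arr (EHom A a b) \<Longrightarrow> FArr (EFHom F a b) \<phi> = FArr (EFHom G a b) \<phi>"
  using assms by (auto simp: eq_on_sesqui_def eq_on_cat_def)

section \<open>2-categories and 2-functors\<close>

context two_category
begin

lemma src_arr: "\<alpha> \<in> Cell C \<Longrightarrow> Src C \<alpha> \<in> Arr C"
  and tgt_arr: "\<alpha> \<in> Cell C \<Longrightarrow> Tgt C \<alpha> \<in> Arr C"
  and vidt_cell: "f \<in> Arr C \<Longrightarrow> VIdt C f \<in> Cell C"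
  and src_vidt: "f \<in> Arr C \<Longrightarrow> Src C (VIdt C f) = f"
  and tgt_vidt: "f \<in> Arr C \<Longrightarrow> Tgt C (VIdt C f) = f"
  using vert.dom_obj vert.cod_obj vert.idt_arr vert.dom_idt vert.cod_idt by simp_all

lemma vcmp_cell: "\<lbrakk>\<alpha> \<in> Cell C; \<beta> \<in> Cell C; Tgt C \<alpha> = Src C \<beta>\<rbrakk> \<Longrightarrow> VCmp C \<beta> \<alpha> \<in> Cell C"
  and src_vcmp: "\<lbrakk>\<alpha> \<in> Cell C; \<beta> \<in> Cell C; Tgt C \<alpha> = Src C \<beta>\<rbrakk> \<Longrightarrow> Src C (VCmp C \<beta> \<alpha>) = Src C \<alpha>"
  and tgt_vcmp: "\<lbrakk>\<alpha> \<in> Cell C; \<beta> \<in> Cell C; Tgt C \<alpha> = Src C \<beta>\<rbrakk> \<Longrightarrow> Tgt C (VCmp C \<beta> \<alpha>) = Tgt C \<beta>"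
  using vert.cmp_arr vert.dom_cmp vert.cod_cmp by simp_all

lemma hcmp_cell:
  "\<lbrakk>\<alpha> \<in> Cell C; \<beta> \<in> Cell C; Cod C (Src C \<alpha>) = Dom C (Src C \<beta>)\<rbrakk> \<Longrightarrow> HCmp C \<beta> \<alpha> \<in> Cell C"
  using horiz.cmp_arr by simp

end

context two_functor
begin

lemma map_cell: "\<alpha> \<in> Cell C \<Longrightarrow> FCell F \<alpha> \<in> Cell D"
  and map_src: "\<alpha> \<in> Cell C \<Longrightarrow> Src D (FCell F \<alpha>) = FArr F (Src C \<alpha>)"
  and map_tgt: "\<alpha> \<in> Cell C \<Longrightarrow> Tgt D (FCell F \<alpha>) = FArr F (Tgt C \<alpha>)"
  and map_vidt: "f \<in> Arr C \<Longrightarrow> FCell F (VIdt C f) = VIdt D (FArr F f)"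
  using vert.map_arr vert.map_dom vert.map_cod vert.map_idt by simp_all

lemma map_vcmp:
  "\<lbrakk>\<alpha> \<in> Cell C; \<beta> \<in> Cell C; Tgt C \<alpha> = Src C \<beta>\<rbrakk>
    \<Longrightarrow> FCell F (VCmp C \<beta> \<alpha>) = VCmp D (FCell F \<beta>) (FCell F \<alpha>)"
  using vert.map_cmp by simp

lemma map_hcmp:
  "\<lbrakk>\<alpha> \<in> Cell C; \<beta> \<in> Cell C; Cod C (Src C \<alpha>) = Dom C (Src C \<beta>)\<rbrakk>
    \<Longrightarrow> FCell F (HCmp C \<beta> \<alpha>) = HCmp D (FCell F \<beta>) (FCell F \<alpha>)"
  using horiz.map_cmp by simp

end

lemma two_functorI:
  fixes F :: "'u func2"
  assumes "two_category C" "two_category D" "cat_functor C D F"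
    and "\<And>\<alpha>. \<alpha> \<in> Cell C \<Longrightarrow> FCell F \<alpha> \<in> Cell D"
    and "\<And>\<alpha>. \<alpha> \<in> Cell C \<Longrightarrow> Src D (FCell F \<alpha>) = FArr F (Src C \<alpha>)"
    and "\<And>\<alpha>. \<alpha> \<in> Cell C \<Longrightarrow> Tgt D (FCell F \<alpha>) = FArr F (Tgt C \<alpha>)"
    and "\<And>f. f \<in> Arr C \<Longrightarrow> FCell F (VIdt C f) = VIdt D (FArr F f)"
    and "\<And>\<alpha> \<beta>. \<lbrakk>\<alpha> \<in> Cell C; \<beta> \<in> Cell C; Tgt C \<alpha> = Src C \<beta>\<rbrakk>
      \<Longrightarrow> FCell F (VCmp C \<beta> \<alpha>) = VCmp D (FCell F \<beta>) (FCell F \<alpha>)"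
    and "\<And>\<alpha> \<beta>. \<lbrakk>\<alpha> \<in> Cell C; \<beta> \<in> Cell C; Cod C (Src C \<alpha>) = Dom C (Src C \<beta>)\<rbrakk>
      \<Longrightarrow> FCell F (HCmp C \<beta> \<alpha>) = HCmp D (FCell F \<beta>) (FCell F \<alpha>)"
  shows "two_functor C D F"
proof -
  interpret C: two_category C by fact
  interpret D: two_category D by fact
  interpret F: cat_functor C D F by fact
  show ?thesis
    by unfold_locales (simp_all add: assms F.map_obj F.map_arr F.map_dom F.map_cod F.map_idt
        F.map_cmp C.src_arr C.tgt_arr C.idt_arr)
qed

context gray_bifunctor
begin

lemma bl_arr: "\<lbrakk>f \<in> Arr A; y \<in> Obj B\<rbrakk> \<Longrightarrow> BL T f y \<in> Arr C"
  and dom_bl: "\<lbrakk>f \<in> Arr A; y \<in> Obj B\<rbrakk> \<Longrightarrow> Dom C (BL T f y) = BObj T (Dom A f) y"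
  and cod_bl: "\<lbrakk>f \<in> Arr A; y \<in> Obj B\<rbrakk> \<Longrightarrow> Cod C (BL T f y) = BObj T (Cod A f) y"
  using cat_functor.map_arr[OF two_functor.axioms(3)[OF left]]
    cat_functor.map_dom[OF two_functor.axioms(3)[OF left]]
    cat_functor.map_cod[OF two_functor.axioms(3)[OF left]] by auto

lemma br_arr: "\<lbrakk>x \<in> Obj A; g \<in> Arr B\<rbrakk> \<Longrightarrow> BR T x g \<in> Arr C"
  and dom_br: "\<lbrakk>x \<in> Obj A; g \<in> Arr B\<rbrakk> \<Longrightarrow> Dom C (BR T x g) = BObj T x (Dom B g)"
  and cod_br: "\<lbrakk>x \<in> Obj A; g \<in> Arr B\<rbrakk> \<Longrightarrow> Cod C (BR T x g) = BObj T x (Cod B g)"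
  using cat_functor.map_arr[OF two_functor.axioms(3)[OF right]]
    cat_functor.map_dom[OF two_functor.axioms(3)[OF right]]
    cat_functor.map_cod[OF two_functor.axioms(3)[OF right]] by auto

lemma bl2_cell: "\<lbrakk>\<alpha> \<in> Cell A; y \<in> Obj B\<rbrakk> \<Longrightarrow> BL2 T \<alpha> y \<in> Cell C"
  and src_bl2: "\<lbrakk>\<alpha> \<in> Cell A; y \<in> Obj B\<rbrakk> \<Longrightarrow> Src C (BL2 T \<alpha> y) = BL T (Src A \<alpha>) y"
  and tgt_bl2: "\<lbrakk>\<alpha> \<in> Cell A; y \<in> Obj B\<rbrakk> \<Longrightarrow> Tgt C (BL2 T \<alpha> y) = BL T (Tgt A \<alpha>) y"
  using two_functor.map_cell[OF left] two_functor.map_src[OF left] two_functor.map_tgt[OF left]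
  by auto

lemma br2_cell: "\<lbrakk>x \<in> Obj A; \<beta> \<in> Cell B\<rbrakk> \<Longrightarrow> BR2 T x \<beta> \<in> Cell C"
  and src_br2: "\<lbrakk>x \<in> Obj A; \<beta> \<in> Cell B\<rbrakk> \<Longrightarrow> Src C (BR2 T x \<beta>) = BR T x (Src B \<beta>)"
  and tgt_br2: "\<lbrakk>x \<in> Obj A; \<beta> \<in> Cell B\<rbrakk> \<Longrightarrow> Tgt C (BR2 T x \<beta>) = BR T x (Tgt B \<beta>)"
  using two_functor.map_cell[OF right] two_functor.map_src[OF right] two_functor.map_tgt[OF right]
  by auto

end

section \<open>Composition of Gray-functors\<close>

lemma cat_functor_comp:
  assumes "cat_functor C D F" "cat_functor D E G"
  shows "cat_functor C E \<lparr>FObj = FObj G \<circ> FObj F, FArr = FArr G \<circ> FArr F, \<dots> = r\<rparr>"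
proof -
  interpret F: cat_functor C D F by fact
  interpret G: cat_functor D E G by fact
  show ?thesis
    by unfold_locales (simp_all add: F.map_obj F.map_arr F.map_dom F.map_cod F.map_idt F.map_cmp
        G.map_obj G.map_arr G.map_dom G.map_cod G.map_idt G.map_cmp)
qed

lemma two_functor_comp:
  assumes "two_functor C D F" "two_functor D E G"
  shows "two_functor C E (func2_comp G F)"
proof -
  interpret F: two_functor C D F by fact
  interpret G: two_functor D E G by fact
  show ?thesis
  proof (rule two_functorI)
    show "cat_functor C E (func2_comp G F)"
      unfolding func2_comp_def by (rule cat_functor_comp) unfold_locales
  qed (simp_all add: F.source.two_category_axioms G.target.two_category_axioms F.map_cell
      F.map_src F.map_tgt F.map_vidt F.map_vcmp F.map_hcmp G.map_cell G.map_src G.map_tgt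
      G.map_vidt G.map_vcmp G.map_hcmp F.map_arr F.map_dom F.map_cod F.source.src_arr)
qed

lemma sesquifunctor_comp:
  assumes "sesquifunctor A B F" "sesquifunctor B C G"
  shows "sesquifunctor A C (sesqui_comp G F)"
proof -
  interpret F: sesquifunctor A B F by fact
  interpret G: sesquifunctor B C G by fact
  note Fhom = cat_functor.map_obj[OF F.map_hom] cat_functor.map_arr[OF F.map_hom]
  show ?thesis
  proof (intro sesquifunctor.intro sesquifunctor_axioms.intro)
    fix a b assume "a \<in> EOb A" "b \<in> EOb A"
    then show "cat_functor (EHom A a b) (EHom C (EFOb (sesqui_comp G F) a) (EFOb (sesqui_comp G F) b))
        (EFHom (sesqui_comp G F) a b)"
      using cat_functor_comp[OF F.map_hom[of a b] G.map_hom[of "EFOb F a" "EFOb F b"]]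
      by (simp add: func_comp_def F.map_ob)
  qed (simp_all add: F.source.sesquicategory_axioms G.target.sesquicategory_axioms F.map_ob G.map_ob
      Fhom F.map_unit G.map_unit F.map_comp_obj G.map_comp_obj F.map_comp_left G.map_comp_left
      F.map_comp_right G.map_comp_right)
qed

lemma gray_functor_comp:
  assumes "gray_functor A B F" "gray_functor B C G"
  shows "gray_functor A C (gray_comp G F)"
proof -
  interpret F: gray_functor A B F by fact
  interpret G: gray_functor B C G by fact
  note Fhom = two_functor.map_cell[OF F.map_two_hom]
    cat_functor.map_obj[OF two_functor.axioms(3)[OF F.map_two_hom]]
    cat_functor.map_arr[OF two_functor.axioms(3)[OF F.map_two_hom]]
  have ob: "a \<in> EOb A \<Longrightarrow> EFOb F a \<in> EOb B" for a
    using F.map_ob by simp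
  show ?thesis
  proof (intro gray_functor.intro gray_functor_axioms.intro)
    show "sesquifunctor (U_star A) (U_star C) (U_star_fun (gray_comp G F))"
      unfolding U_star_fun_comp by (rule sesquifunctor_comp) unfold_locales
    fix a b assume "a \<in> EOb A" "b \<in> EOb A"
    then show "two_functor (EHom A a b) (EHom C (EFOb (gray_comp G F) a) (EFOb (gray_comp G F) b))
        (EFHom (gray_comp G F) a b)"
      using two_functor_comp[OF F.map_two_hom[of a b] G.map_two_hom[of "EFOb F a" "EFOb F b"]]
      by (simp add: ob)
  qed (simp_all add: F.source.gray_category_axioms G.target.gray_category_axioms ob Fhom
      F.map_comp_left_cell G.map_comp_left_cell F.map_comp_right_cell G.map_comp_right_cell
      F.map_gam G.map_gam)
qed

section \<open>Lifting along functors that are bijective on top-dimensional cells\<close>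

text \<open>
  Full faithfulness of the functors between hom-categories, in one condition: \<open>P\<close> is bijective on
  2-cells with given boundary.
\<close>

definition fully_faithful_on_cells :: "'u twocat \<Rightarrow> 'u twocat \<Rightarrow> 'u func2 \<Rightarrow> bool" where
  "fully_faithful_on_cells X Y P \<longleftrightarrow>
    (\<forall>f\<in>Arr X. \<forall>g\<in>Arr X. \<forall>\<beta>\<in>Cell Y. Dom X f = Dom X g \<and> Cod X f = Cod X g \<and>
       Src Y \<beta> = FArr P f \<and> Tgt Y \<beta> = FArr P g \<longrightarrow>
       (\<exists>!\<alpha>. \<alpha> \<in> Cell X \<and> Src X \<alpha> = f \<and> Tgt X \<alpha> = g \<and> FCell P \<alpha> = \<beta>))"

lemma fully_faithful_on_cells_inj:
  assumes "fully_faithful_on_cells X Y P" "two_functor X Y P"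
    and "\<alpha> \<in> Cell X" "\<beta> \<in> Cell X" "Src X \<alpha> = Src X \<beta>" "Tgt X \<alpha> = Tgt X \<beta>"
    and "FCell P \<alpha> = FCell P \<beta>"
  shows "\<alpha> = \<beta>"
proof -
  interpret P: two_functor X Y P by fact
  have "\<exists>!\<gamma>. \<gamma> \<in> Cell X \<and> Src X \<gamma> = Src X \<alpha> \<and> Tgt X \<gamma> = Tgt X \<alpha> \<and> FCell P \<gamma> = FCell P \<alpha>"
    using assms(1,3) unfolding fully_faithful_on_cells_def
    by (simp add: P.source.src_arr P.source.tgt_arr P.source.dom_tgt P.source.cod_tgt P.map_cell
        P.map_src P.map_tgt)
  then show ?thesis using assms by metis
qed

text \<open>
  Both sides of each equation to be shown are 2-cells of \<open>X\<close> with the same boundary, and \<open>P\<close> sends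
  them to the same 2-cell because \<open>P\<close> and \<open>K\<close> preserve the operation in question.
\<close>

lemma two_functor_lift:
  fixes L :: "'u func2"
  assumes "two_functor X Y P" "fully_faithful_on_cells X Y P" "two_functor B Y K" "cat_functor B X L"
    and cell: "\<And>\<phi>. \<phi> \<in> Cell B \<Longrightarrow> FCell L \<phi> \<in> Cell X \<and> Src X (FCell L \<phi>) = FArr L (Src B \<phi>) \<and>
      Tgt X (FCell L \<phi>) = FArr L (Tgt B \<phi>)"
    and lift: "\<And>\<phi>. \<phi> \<in> Cell B \<Longrightarrow> FCell P (FCell L \<phi>) = FCell K \<phi>"
    and arr: "\<And>f. f \<in> Arr B \<Longrightarrow> FArr P (FArr L f) = FArr K f"
  shows "two_functor B X L"
proof -
  interpret P: two_functor X Y P by fact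
  interpret K: two_functor B Y K by fact
  interpret L: cat_functor B X L by fact
  note inj = fully_faithful_on_cells_inj[OF assms(2,1)]
  show ?thesis
  proof (rule two_functorI)
    fix f assume f: "f \<in> Arr B"
    show "FCell L (VIdt B f) = VIdt X (FArr L f)"
      by (rule inj)
        (simp_all add: f cell lift arr K.source.vidt_cell K.source.src_vidt K.source.tgt_vidt
          P.source.vidt_cell P.source.src_vidt P.source.tgt_vidt L.map_arr P.map_vidt K.map_vidt)
  next
    fix \<alpha> \<beta> assume ab: "\<alpha> \<in> Cell B" "\<beta> \<in> Cell B" "Tgt B \<alpha> = Src B \<beta>"
    show "FCell L (VCmp B \<beta> \<alpha>) = VCmp X (FCell L \<beta>) (FCell L \<alpha>)"
      by (rule inj)
        (simp_all add: ab cell lift K.source.vcmp_cell K.source.src_vcmp K.source.tgt_vcmp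
          P.source.vcmp_cell P.source.src_vcmp P.source.tgt_vcmp P.map_vcmp K.map_vcmp)
  next
    fix \<alpha> \<beta> assume ab: "\<alpha> \<in> Cell B" "\<beta> \<in> Cell B" "Cod B (Src B \<alpha>) = Dom B (Src B \<beta>)"
    show "FCell L (HCmp B \<beta> \<alpha>) = HCmp X (FCell L \<beta>) (FCell L \<alpha>)"
      by (rule inj)
        (simp_all add: ab cell lift K.source.hcmp_cell K.source.src_hcmp K.source.tgt_hcmp
          K.source.src_arr K.source.tgt_arr K.source.dom_tgt K.source.cod_tgt
          P.source.hcmp_cell P.source.src_hcmp P.source.tgt_hcmp P.map_hcmp K.map_hcmp
          L.map_dom L.map_cod L.map_cmp)
  qed (simp_all add: cell K.source.two_category_axioms P.source.two_category_axioms assms(4))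
qed

definition locally_fully_faithful_on_cells :: "'u gray \<Rightarrow> 'u gray \<Rightarrow> 'u gray_fun \<Rightarrow> bool" where
  "locally_fully_faithful_on_cells X Y P \<longleftrightarrow>
    (\<forall>a\<in>EOb X. \<forall>b\<in>EOb X.
       fully_faithful_on_cells (EHom X a b) (EHom Y (EFOb P a) (EFOb P b)) (EFHom P a b))"

text \<open>
  The extension of a sesquifunctor to 3-cells. Existence of the value on a 3-cell comes from fullness
  of \<open>P\<close> on 3-cells; that these values respect whiskering and interchangers comes from faithfulness,
  because the boundaries of both sides agree by sesquifunctoriality and their images under \<open>P\<close> agree
  by functoriality of \<open>P\<close> and \<open>K\<close>.
\<close>

lemma gray_functor_lift:
  assumes P: "gray_functor X Y P" and ff: "locally_fully_faithful_on_cells X Y P"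
    and K: "gray_functor B Y K" and L\<^sub>0: "sesquifunctor (U_star B) (U_star X) L\<^sub>0"
    and eq: "eq_on_sesqui (U_star B) (sesqui_comp (U_star_fun P) L\<^sub>0) (U_star_fun K)"
  obtains L where "gray_functor B X L" "U_star_fun L = L\<^sub>0" "eq_on_gray B (gray_comp P L) K"
proof -
  interpret P: gray_functor X Y P by fact
  interpret K: gray_functor B Y K by fact
  interpret L\<^sub>0: sesquifunctor "U_star B" "U_star X" L\<^sub>0 by fact
  \<comment> \<open>the only 3-cell that can lie over \<open>K \<phi>\<close> and have the boundary prescribed by \<open>L\<^sub>0\<close>\<close>
  define lift where "lift a b \<phi> = (THE \<theta>. \<theta> \<in> Cell (EHom X (EFOb L\<^sub>0 a) (EFOb L\<^sub>0 b)) \<and>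
      Src (EHom X (EFOb L\<^sub>0 a) (EFOb L\<^sub>0 b)) \<theta> = FArr (EFHom L\<^sub>0 a b) (Src (EHom B a b) \<phi>) \<and>
      Tgt (EHom X (EFOb L\<^sub>0 a) (EFOb L\<^sub>0 b)) \<theta> = FArr (EFHom L\<^sub>0 a b) (Tgt (EHom B a b) \<phi>) \<and>
      FCell (EFHom P (EFOb L\<^sub>0 a) (EFOb L\<^sub>0 b)) \<theta> = FCell (EFHom K a b) \<phi>)" for a b \<phi>
  define L :: "'a gray_fun" where "L = \<lparr>EFOb = EFOb L\<^sub>0, EFHom = (\<lambda>a b.
      \<lparr>FObj = FObj (EFHom L\<^sub>0 a b), FArr = FArr (EFHom L\<^sub>0 a b), FCell = lift a b\<rparr>)\<rparr>"
  have UL: "U_star_fun L = L\<^sub>0"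
    by (auto simp: L_def U_star_fun_def func.truncate_def intro!: enriched_fun.equality ext func.equality)
  have ob [simp]: "EFOb L a \<in> EOb X" if "a \<in> EOb B" for a
    using that L\<^sub>0.map_ob by (simp add: L_def)
  have P_ob [simp]: "EFOb P (EFOb L a) = EFOb K a" if "a \<in> EOb B" for a
    using eq_on_sesquiD(1)[OF eq] that by (simp add: L_def)
  have P_obj [simp]: "FObj (EFHom P (EFOb L a) (EFOb L b)) (FObj (EFHom L a b) f) = FObj (EFHom K a b) f"
    if "a \<in> EOb B" "b \<in> EOb B" "f \<in> Obj (EHom B a b)" for a b f
    using eq_on_sesquiD(2)[OF eq, of a b f] that by (simp add: L_def)
  have P_arr [simp]: "FArr (EFHom P (EFOb L a) (EFOb L b)) (FArr (EFHom L a b) f) = FArr (EFHom K a b) f"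
    if "a \<in> EOb B" "b \<in> EOb B" "f \<in> Arr (EHom B a b)" for a b f
    using eq_on_sesquiD(3)[OF eq, of a b f] that by (simp add: L_def)
  have P_hom: "two_functor (EHom X (EFOb L a) (EFOb L b)) (EHom Y (EFOb K a) (EFOb K b))
      (EFHom P (EFOb L a) (EFOb L b))" if "a \<in> EOb B" "b \<in> EOb B" for a b
    using P.map_two_hom[of "EFOb L a" "EFOb L b"] that by simp
  have ff_hom: "fully_faithful_on_cells (EHom X (EFOb L a) (EFOb L b)) (EHom Y (EFOb K a) (EFOb K b))
      (EFHom P (EFOb L a) (EFOb L b))" if "a \<in> EOb B" "b \<in> EOb B" for a b
    using ff[unfolded locally_fully_faithful_on_cells_def, rule_format, of "EFOb L a" "EFOb L b"]
      that by simp
  have hom_functor: "cat_functor (EHom B a b) (EHom X (EFOb L a) (EFOb L b)) (EFHom L a b)"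
    if "a \<in> EOb B" "b \<in> EOb B" for a b
    using L\<^sub>0.map_hom[of a b] that unfolding UL[symmetric] by simp
  have cell: "FCell (EFHom L a b) \<phi> \<in> Cell (EHom X (EFOb L a) (EFOb L b)) \<and>
      Src (EHom X (EFOb L a) (EFOb L b)) (FCell (EFHom L a b) \<phi>) = FArr (EFHom L a b) (Src (EHom B a b) \<phi>) \<and>
      Tgt (EHom X (EFOb L a) (EFOb L b)) (FCell (EFHom L a b) \<phi>) = FArr (EFHom L a b) (Tgt (EHom B a b) \<phi>) \<and>
      FCell (EFHom P (EFOb L a) (EFOb L b)) (FCell (EFHom L a b) \<phi>) = FCell (EFHom K a b) \<phi>"
    if ab: "a \<in> EOb B" "b \<in> EOb B" and \<phi>: "\<phi> \<in> Cell (EHom B a b)" for a b \<phi>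
  proof -
    interpret Kh: two_functor "EHom B a b" "EHom Y (EFOb K a) (EFOb K b)" "EFHom K a b"
      by (rule K.map_two_hom[OF ab])
    interpret Lh: cat_functor "EHom B a b" "EHom X (EFOb L a) (EFOb L b)" "EFHom L a b"
      by (rule hom_functor[OF ab])
    have "\<exists>!\<theta>. \<theta> \<in> Cell (EHom X (EFOb L a) (EFOb L b)) \<and>
      Src (EHom X (EFOb L a) (EFOb L b)) \<theta> = FArr (EFHom L a b) (Src (EHom B a b) \<phi>) \<and>
      Tgt (EHom X (EFOb L a) (EFOb L b)) \<theta> = FArr (EFHom L a b) (Tgt (EHom B a b) \<phi>) \<and>
      FCell (EFHom P (EFOb L a) (EFOb L b)) \<theta> = FCell (EFHom K a b) \<phi>"
      using ff_hom[OF ab] ab \<phi>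
      unfolding fully_faithful_on_cells_def
      by (simp add: Kh.source.src_arr Kh.source.tgt_arr Kh.source.dom_tgt Kh.source.cod_tgt
          Kh.map_cell Kh.map_src Kh.map_tgt Lh.map_arr Lh.map_dom Lh.map_cod)
    from theI'[OF this] show ?thesis by (simp add: L_def lift_def)
  qed
  have two_functor: "two_functor (EHom B a b) (EHom X (EFOb L a) (EFOb L b)) (EFHom L a b)"
    if ab: "a \<in> EOb B" "b \<in> EOb B" for a b
    by (rule two_functor_lift[OF P_hom[OF ab] ff_hom[OF ab] K.map_two_hom[OF ab] hom_functor[OF ab]])
      (simp_all add: ab cell)
  have "gray_functor B X L"
  proof -
    note inj = fully_faithful_on_cells_inj[OF ff_hom P_hom]
    have sesqui: "sesquifunctor (U_star B) (U_star X) (U_star_fun L)"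
      using L\<^sub>0 UL by simp
    note Lhom = cat_functor.map_obj[OF hom_functor] cat_functor.map_arr[OF hom_functor]
      cat_functor.map_dom[OF hom_functor] cat_functor.map_cod[OF hom_functor]
      cat_functor.map_cmp[OF hom_functor]
    show ?thesis
    proof (intro gray_functor.intro gray_functor_axioms.intro)
      fix a b c f \<psi>
      assume abc: "a \<in> EOb B" "b \<in> EOb B" "c \<in> EOb B"
        and f: "f \<in> Obj (EHom B a b)" and \<psi>: "\<psi> \<in> Cell (EHom B b c)"
      interpret TB: gray_bifunctor "EHom B b c" "EHom B a b" "EHom B a c" "EComp B a b c"
        using abc by (simp add: K.source.comp_gray_bifunctor)
      interpret TX: gray_bifunctor "EHom X (EFOb L b) (EFOb L c)" "EHom X (EFOb L a) (EFOb L b)"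
        "EHom X (EFOb L a) (EFOb L c)" "EComp X (EFOb L a) (EFOb L b) (EFOb L c)"
        using abc by (simp add: P.source.comp_gray_bifunctor)
      show "FCell (EFHom L a c) (BL2 (EComp B a b c) \<psi> f) =
        BL2 (EComp X (EFOb L a) (EFOb L b) (EFOb L c)) (FCell (EFHom L b c) \<psi>) (FObj (EFHom L a b) f)"
        by (rule inj[OF abc(1,3) abc(1,3)])
          (simp_all add: abc f \<psi> cell TB.bl2_cell TB.src_bl2 TB.tgt_bl2 TX.bl2_cell TX.src_bl2
            TX.tgt_bl2 Lhom P.map_comp_left_cell K.map_comp_left_cell
            sesquifunctor.map_comp_left[OF sesqui, simplified] TB.A.src_arr TB.A.tgt_arr)
    next
      fix a b c \<phi> g
      assume abc: "a \<in> EOb B" "b \<in> EOb B" "c \<in> EOb B"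
        and g: "g \<in> Obj (EHom B b c)" and \<phi>: "\<phi> \<in> Cell (EHom B a b)"
      interpret TB: gray_bifunctor "EHom B b c" "EHom B a b" "EHom B a c" "EComp B a b c"
        using abc by (simp add: K.source.comp_gray_bifunctor)
      interpret TX: gray_bifunctor "EHom X (EFOb L b) (EFOb L c)" "EHom X (EFOb L a) (EFOb L b)"
        "EHom X (EFOb L a) (EFOb L c)" "EComp X (EFOb L a) (EFOb L b) (EFOb L c)"
        using abc by (simp add: P.source.comp_gray_bifunctor)
      show "FCell (EFHom L a c) (BR2 (EComp B a b c) g \<phi>) =
        BR2 (EComp X (EFOb L a) (EFOb L b) (EFOb L c)) (FObj (EFHom L b c) g) (FCell (EFHom L a b) \<phi>)"
        by (rule inj[OF abc(1,3) abc(1,3)])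
          (simp_all add: abc g \<phi> cell TB.br2_cell TB.src_br2 TB.tgt_br2 TX.br2_cell TX.src_br2
            TX.tgt_br2 Lhom P.map_comp_right_cell K.map_comp_right_cell
            sesquifunctor.map_comp_right[OF sesqui, simplified] TB.B.src_arr TB.B.tgt_arr)
    next
      fix a b c \<phi> \<psi>
      assume abc: "a \<in> EOb B" "b \<in> EOb B" "c \<in> EOb B"
        and \<phi>: "\<phi> \<in> Arr (EHom B a b)" and \<psi>: "\<psi> \<in> Arr (EHom B b c)"
      interpret TB: gray_bifunctor "EHom B b c" "EHom B a b" "EHom B a c" "EComp B a b c"
        using abc by (simp add: K.source.comp_gray_bifunctor)
      interpret TX: gray_bifunctor "EHom X (EFOb L b) (EFOb L c)" "EHom X (EFOb L a) (EFOb L b)"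
        "EHom X (EFOb L a) (EFOb L c)" "EComp X (EFOb L a) (EFOb L b) (EFOb L c)"
        using abc by (simp add: P.source.comp_gray_bifunctor)
      show "FCell (EFHom L a c) (Gam (EComp B a b c) \<psi> \<phi>) =
        Gam (EComp X (EFOb L a) (EFOb L b) (EFOb L c)) (FArr (EFHom L b c) \<psi>) (FArr (EFHom L a b) \<phi>)"
        by (rule inj[OF abc(1,3) abc(1,3)])
          (simp_all add: abc \<phi> \<psi> cell TB.gam_cell TB.src_gam TB.tgt_gam TX.gam_cell TX.src_gam
            TX.tgt_gam Lhom P.map_gam K.map_gam
            sesquifunctor.map_comp_left[OF sesqui, simplified]
            sesquifunctor.map_comp_right[OF sesqui, simplified]
            TB.A.dom_obj TB.A.cod_obj TB.B.dom_obj TB.B.cod_obj TB.bl_arr TB.br_arr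
            TB.dom_bl TB.cod_bl TB.dom_br TB.cod_br)
    qed (use two_functor sesqui in \<open>simp_all add: P.source.gray_category_axioms
        K.source.gray_category_axioms\<close>)
  qed
  moreover have "eq_on_gray B (gray_comp P L) K"
    using cell eq UL by (intro eq_on_grayI) (simp_all add: U_star_fun_comp)
  ultimately show thesis using UL that by blast
qed

text \<open>
  The uniqueness counterpart of the lifting lemma: the values of \<open>H\<close> and \<open>H'\<close> on a 3-cell have
  the same boundary and the same image under \<open>P\<close>.
\<close>

lemma eq_on_gray_if_locally_fully_faithful:
  assumes P: "gray_functor X Y P" and ff: "locally_fully_faithful_on_cells X Y P"
    and H: "gray_functor A X H" and H': "gray_functor A X H'"
    and eq: "eq_on_sesqui (U_star A) (U_star_fun H) (U_star_fun H')"
    and cell: "\<And>a b \<phi>. \<lbrakk>a \<in> EOb A; b \<in> EOb A; \<phi> \<in> Cell (EHom A a b)\<rbrakk> \<Longrightarrow>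
      FCell (EFHom (gray_comp P H) a b) \<phi> = FCell (EFHom (gray_comp P H') a b) \<phi>"
  shows "eq_on_gray A H H'"
proof (rule eq_on_grayI[OF eq])
  interpret P: gray_functor X Y P by fact
  interpret H: gray_functor A X H by fact
  interpret H': gray_functor A X H' by fact
  fix a b \<phi> assume a: "a \<in> EOb A" "b \<in> EOb A" and \<phi>: "\<phi> \<in> Cell (EHom A a b)"
  have ob: "EFOb H' a = EFOb H a" "EFOb H' b = EFOb H b" "EFOb H a \<in> EOb X" "EFOb H b \<in> EOb X"
    using eq_on_sesquiD(1)[OF eq, of a] eq_on_sesquiD(1)[OF eq, of b] H.map_ob[of a] H.map_ob[of b] a
    by simp_all
  interpret Ha: two_functor "EHom A a b" "EHom X (EFOb H a) (EFOb H b)" "EFHom H a b"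
    by (rule H.map_two_hom[OF a])
  interpret Ha': two_functor "EHom A a b" "EHom X (EFOb H a) (EFOb H b)" "EFHom H' a b"
    using H'.map_two_hom[OF a] by (simp add: ob)
  have arr: "FArr (EFHom H a b) f = FArr (EFHom H' a b) f" if "f \<in> Arr (EHom A a b)" for f
    using eq_on_sesquiD(3)[OF eq, of a b f] a that by simp
  show "FCell (EFHom H a b) \<phi> = FCell (EFHom H' a b) \<phi>"
    by (rule fully_faithful_on_cells_inj[OF _ P.map_two_hom[OF ob(3,4)]])
      (use ff ob cell[OF a \<phi>] in \<open>simp_all add: locally_fully_faithful_on_cells_def Ha.map_cell
        Ha.map_src Ha.map_tgt Ha'.map_cell Ha'.map_src Ha'.map_tgt arr \<phi> Ha.source.src_arr
        Ha.source.tgt_arr\<close>)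
qed

section \<open>Trivial fibrations\<close>

text \<open>
  The objects of the hom-categories are the 1-cells, so surjectivity on objects of the functors
  between hom-categories is fullness of the underlying functor; what is left of the local conditions
  concerns 2-cells only.
\<close>

lemma two_trivial_fibration_iff:
  "two_trivial_fibration C D F \<longleftrightarrow> two_functor C D F \<and> surjective_on_objects C D F \<and>
     full C D F \<and> fully_faithful_on_cells C D F"
proof (cases "two_functor C D F")
  case True
  then interpret F: two_functor C D F .
  let ?Fh = "\<lparr>FObj = FArr F, FArr = FCell F\<rparr>"
  have surj: "(\<forall>x\<in>Obj C. \<forall>y\<in>Obj C. surjective_on_objects (hom_cat C x y)
      (hom_cat D (FObj F x) (FObj F y)) ?Fh) \<longleftrightarrow> full C D F"
  proof -
    have "surjective_on_objects (hom_cat C x y) (hom_cat D (FObj F x) (FObj F y)) ?Fh \<longleftrightarrow>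
        (\<forall>g\<in>Arr D. Dom D g = FObj F x \<and> Cod D g = FObj F y \<longrightarrow>
           (\<exists>f\<in>Arr C. Dom C f = x \<and> Cod C f = y \<and> FArr F f = g))" (is "?l \<longleftrightarrow> ?r") for x y
    proof -
      have "?l \<longleftrightarrow> {g \<in> Arr D. Dom D g = FObj F x \<and> Cod D g = FObj F y} \<subseteq>
          FArr F ` {f \<in> Arr C. Dom C f = x \<and> Cod C f = y}"
        by (auto simp: surjective_on_objects_def hom_cat_def F.map_arr F.map_dom F.map_cod)
      then show ?thesis by blast
    qed
    then show ?thesis by (simp add: full_def)
  qed
  have "(\<forall>x\<in>Obj C. \<forall>y\<in>Obj C. full (hom_cat C x y) (hom_cat D (FObj F x) (FObj F y)) ?Fh \<and>
      faithful (hom_cat C x y) ?Fh) \<longleftrightarrow> fully_faithful_on_cells C D F" (is "?l \<longleftrightarrow> ?r")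
  proof
    assume l: ?l
    show ?r
      unfolding fully_faithful_on_cells_def
    proof (intro ballI impI)
      fix f g \<beta>
      assume fg: "f \<in> Arr C" "g \<in> Arr C" "\<beta> \<in> Cell D"
        "Dom C f = Dom C g \<and> Cod C f = Cod C g \<and> Src D \<beta> = FArr F f \<and> Tgt D \<beta> = FArr F g"
      have h: "full (hom_cat C (Dom C f) (Cod C f))
          (hom_cat D (FObj F (Dom C f)) (FObj F (Cod C f))) ?Fh"
        "faithful (hom_cat C (Dom C f) (Cod C f)) ?Fh"
        using l fg by (auto simp: F.source.dom_obj F.source.cod_obj)
      show "\<exists>!\<alpha>. \<alpha> \<in> Cell C \<and> Src C \<alpha> = f \<and> Tgt C \<alpha> = g \<and> FCell F \<alpha> = \<beta>"
      proof (rule ex_ex1I)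
        show "\<exists>\<alpha>. \<alpha> \<in> Cell C \<and> Src C \<alpha> = f \<and> Tgt C \<alpha> = g \<and> FCell F \<alpha> = \<beta>"
          using h(1)[unfolded full_def, rule_format, of f g \<beta>] fg
          by (auto simp: hom_cat_def F.map_dom F.map_cod)
      next
        fix \<alpha> \<alpha>'
        assume "\<alpha> \<in> Cell C \<and> Src C \<alpha> = f \<and> Tgt C \<alpha> = g \<and> FCell F \<alpha> = \<beta>"
          and "\<alpha>' \<in> Cell C \<and> Src C \<alpha>' = f \<and> Tgt C \<alpha>' = g \<and> FCell F \<alpha>' = \<beta>"
        then show "\<alpha> = \<alpha>'"
          using h(2)[unfolded faithful_def, rule_format, of \<alpha> \<alpha>'] by (simp add: hom_cat_def)
      qed
    qed
  next
    assume r: ?r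
    show ?l
    proof (intro ballI conjI)
      fix x y assume "x \<in> Obj C" "y \<in> Obj C"
      show "full (hom_cat C x y) (hom_cat D (FObj F x) (FObj F y)) ?Fh"
        unfolding full_def
      proof (intro ballI impI)
        fix f g \<beta>
        assume "f \<in> Obj (hom_cat C x y)" "g \<in> Obj (hom_cat C x y)"
          "\<beta> \<in> Arr (hom_cat D (FObj F x) (FObj F y))"
          "Dom (hom_cat D (FObj F x) (FObj F y)) \<beta> = FObj ?Fh f \<and>
           Cod (hom_cat D (FObj F x) (FObj F y)) \<beta> = FObj ?Fh g"
        then show "\<exists>\<alpha>\<in>Arr (hom_cat C x y). Dom (hom_cat C x y) \<alpha> = f \<and>
            Cod (hom_cat C x y) \<alpha> = g \<and> FArr ?Fh \<alpha> = \<beta>"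
          using r[unfolded fully_faithful_on_cells_def, rule_format, of f g \<beta>]
          by (auto simp: hom_cat_def)
      qed
      show "faithful (hom_cat C x y) ?Fh"
        unfolding faithful_def
        by (intro ballI impI, rule fully_faithful_on_cells_inj[OF r True]) (simp_all add: hom_cat_def)
    qed
  qed
  with surj True show ?thesis
    unfolding two_trivial_fibration_def Let_def by blast
qed (simp add: two_trivial_fibration_def)

text \<open>
  Separates a trivial fibration into a condition on cells of dimension at most 2, which is the one
  imposed on surjections of sesquicategories, and a condition on 3-cells.
\<close>

lemma gray_trivial_fibration_iff:
  "gray_trivial_fibration X Y P \<longleftrightarrow> gray_functor X Y P \<and>
     sesqui_surjective (U_star X) (U_star Y) (U_star_fun P) \<and> locally_fully_faithful_on_cells X Y P"
proof (cases "gray_functor X Y P")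
  case True
  have [simp]: "surjective_on_objects (cat.truncate C) (cat.truncate D) (func.truncate F) \<longleftrightarrow>
      surjective_on_objects C D F" "full (cat.truncate C) (cat.truncate D) (func.truncate F) \<longleftrightarrow>
      full C D F" for C D :: "'a twocat" and F :: "'a func2"
    by (simp_all add: surjective_on_objects_def full_def)
  have "\<forall>a\<in>EOb X. \<forall>b\<in>EOb X.
      two_functor (EHom X a b) (EHom Y (EFOb P a) (EFOb P b)) (EFHom P a b)"
    using True by (simp add: gray_functor.map_two_hom)
  then show ?thesis
    using True gray_functor.axioms(3)[OF True]
    by (simp add: gray_trivial_fibration_def sesqui_surjective_def two_trivial_fibration_iff
        locally_fully_faithful_on_cells_def) blast
qed (simp add: gray_trivial_fibration_def)

section \<open>The terminal Gray-category\<close>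

text \<open>
  The terminal Gray-category serves as the base of lifting problems whose only content is that
  3-cells are determined by their boundary. The single cell in each dimension is \<open>undefined\<close>, an
  arbitrary element of the universe.
\<close>

definition terminal_two_category :: "'u twocat" where
  "terminal_two_category =
    \<lparr>Obj = {undefined}, Arr = {undefined}, Dom = (\<lambda>_. undefined), Cod = (\<lambda>_. undefined),
     Idt = (\<lambda>_. undefined), Cmp = (\<lambda>_ _. undefined),
     Cell = {undefined}, Src = (\<lambda>_. undefined), Tgt = (\<lambda>_. undefined),
     VIdt = (\<lambda>_. undefined), VCmp = (\<lambda>_ _. undefined), HCmp = (\<lambda>_ _. undefined)\<rparr>"

definition terminal_gray :: "'u gray" where
  "terminal_gray = \<lparr>EOb = {undefined}, EHom = (\<lambda>_ _. terminal_two_category), EUnit = (\<lambda>_. undefined),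
     EComp = (\<lambda>_ _ _. \<lparr>BObj = (\<lambda>_ _. undefined), BL = (\<lambda>_ _. undefined), BR = (\<lambda>_ _. undefined),
       BL2 = (\<lambda>_ _. undefined), BR2 = (\<lambda>_ _. undefined), Gam = (\<lambda>_ _. undefined)\<rparr>)\<rparr>"

definition to_terminal_gray :: "'u gray_fun" where
  "to_terminal_gray = \<lparr>EFOb = (\<lambda>_. undefined), EFHom = (\<lambda>_ _.
     \<lparr>FObj = (\<lambda>_. undefined), FArr = (\<lambda>_. undefined), FCell = (\<lambda>_. undefined)\<rparr>)\<rparr>"

lemma two_category_terminal: "two_category terminal_two_category"
  by unfold_locales (simp_all add: terminal_two_category_def)

lemma two_functor_to_terminal:
  assumes "two_category C"
  shows "two_functor C terminal_two_category
    \<lparr>FObj = (\<lambda>_. undefined), FArr = (\<lambda>_. undefined), FCell = (\<lambda>_. undefined)\<rparr>"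
proof -
  interpret C: two_category C by fact
  interpret T: two_category "terminal_two_category :: 'a twocat" by (rule two_category_terminal)
  show ?thesis by unfold_locales (simp_all add: terminal_two_category_def)
qed

lemma cat_functor_to_terminal:
  assumes "category C"
  shows "cat_functor C (cat.truncate terminal_two_category)
    \<lparr>FObj = (\<lambda>_. undefined), FArr = (\<lambda>_. undefined)\<rparr>"
proof -
  interpret C: category C by fact
  interpret T: two_category "terminal_two_category :: 'a twocat" by (rule two_category_terminal)
  show ?thesis
    using T.category_axioms
    by (unfold_locales) (simp_all add: terminal_two_category_def)
qed

lemma terminal_gray_sel [simp]:
  "EOb terminal_gray = {undefined}" "EHom terminal_gray a b = terminal_two_category"
  "EUnit terminal_gray a = undefined"
  "BObj (EComp terminal_gray a b c) x y = undefined" "BL (EComp terminal_gray a b c) f y = undefined"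
  "BR (EComp terminal_gray a b c) x g = undefined" "BL2 (EComp terminal_gray a b c) \<alpha> y = undefined"
  "BR2 (EComp terminal_gray a b c) x \<beta> = undefined" "Gam (EComp terminal_gray a b c) f g = undefined"
  by (simp_all add: terminal_gray_def)

lemma gray_category_terminal: "gray_category terminal_gray"
proof -
  interpret T: two_category "terminal_two_category :: 'a twocat" by (rule two_category_terminal)
  have c: "category (cat.truncate (terminal_two_category :: 'a twocat))"
    using T.category_axioms by simp
  have "gray_bifunctor (terminal_two_category :: 'a twocat) terminal_two_category
      terminal_two_category (EComp terminal_gray a b c)" for a b c :: 'a
    by unfold_locales (simp_all add: terminal_gray_def two_functor_to_terminal T.two_category_axioms,
        simp_all add: terminal_two_category_def)
  moreover have "funny_functor (cat.truncate (terminal_two_category :: 'a twocat))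
      (cat.truncate terminal_two_category) (cat.truncate terminal_two_category)
      (bifunc.truncate (EComp terminal_gray a b c))" for a b c :: 'a
    by (intro funny_functor.intro funny_functor_axioms.intro)
      (simp_all add: terminal_gray_def T.category_axioms cat_functor_to_terminal[OF c])
  ultimately show ?thesis
    by (intro gray_category.intro sesquicategory.intro gray_category_axioms.intro)
      (simp_all add: c T.two_category_axioms T.category_axioms, simp_all add: terminal_two_category_def)
qed

lemma gray_functor_to_terminal:
  assumes "gray_category X"
  shows "gray_functor X terminal_gray to_terminal_gray"
proof -
  interpret X: gray_category X by fact
  interpret T: gray_category "terminal_gray :: 'a gray" by (rule gray_category_terminal)
  have h: "two_functor (EHom X a b) terminal_two_category (EFHom to_terminal_gray a b)"
    if "a \<in> EOb X" "b \<in> EOb X" for a b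
    using that by (simp add: to_terminal_gray_def two_functor_to_terminal X.hom_two_category)
  then have h1: "cat_functor (EHom X a b) terminal_two_category (EFHom to_terminal_gray a b)"
    if "a \<in> EOb X" "b \<in> EOb X" for a b
    using that two_functor.axioms(3) by blast
  show ?thesis
    by (intro gray_functor.intro sesquifunctor.intro sesquifunctor_axioms.intro
        gray_functor_axioms.intro)
      (simp_all add: X.gray_category_axioms T.gray_category_axioms X.sesquicategory_axioms
        T.sesquicategory_axioms h h1, simp_all add: to_terminal_gray_def)
qed

lemma terminal_gray_cell_unique:
  assumes "\<alpha> \<in> Cell (EHom terminal_gray a b)" "\<beta> \<in> Cell (EHom terminal_gray a b)"
  shows "\<alpha> = \<beta>"
  using assms by (simp add: terminal_two_category_def)

section \<open>Indiscrete Gray-categories\<close>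

text \<open>
  The 3-cells of an indiscrete Gray-category are pairs of parallel 2-cells and have to be elements of
  the same universe as the 2-cells.
\<close>

locale pairing =
  fixes pair :: "'u \<Rightarrow> 'u \<Rightarrow> 'u" and left right :: "'u \<Rightarrow> 'u"
  assumes left_pair [simp]: "left (pair x y) = x" and right_pair [simp]: "right (pair x y) = y"
begin

text \<open>
  The locally indiscrete 2-category on a category: one 2-cell between any two parallel arrows. Its
  2-cells are the codes of pairs of parallel arrows; as \<open>left\<close> and \<open>right\<close> have values also on
  elements that are not codes, being a code is part of the description.
\<close>

definition indiscrete :: "'u cat \<Rightarrow> 'u twocat" where
  "indiscrete C = \<lparr>Obj = Obj C, Arr = Arr C, Dom = Dom C, Cod = Cod C, Idt = Idt C, Cmp = Cmp C,
     Cell = {\<alpha>. pair (left \<alpha>) (right \<alpha>) = \<alpha> \<and> left \<alpha> \<in> Arr C \<and> right \<alpha> \<in> Arr C \<and>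
       Dom C (left \<alpha>) = Dom C (right \<alpha>) \<and> Cod C (left \<alpha>) = Cod C (right \<alpha>)},
     Src = left, Tgt = right, VIdt = (\<lambda>f. pair f f), VCmp = (\<lambda>\<beta> \<alpha>. pair (left \<alpha>) (right \<beta>)),
     HCmp = (\<lambda>\<beta> \<alpha>. pair (Cmp C (left \<beta>) (left \<alpha>)) (Cmp C (right \<beta>) (right \<alpha>)))\<rparr>"

lemma indiscrete_sel [simp]:
  "Obj (indiscrete C) = Obj C" "Arr (indiscrete C) = Arr C" "Dom (indiscrete C) = Dom C"
  "Cod (indiscrete C) = Cod C" "Idt (indiscrete C) = Idt C" "Cmp (indiscrete C) = Cmp C"
  "Cell (indiscrete C) = {\<alpha>. pair (left \<alpha>) (right \<alpha>) = \<alpha> \<and> left \<alpha> \<in> Arr C \<and> right \<alpha> \<in> Arr C \<and>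
     Dom C (left \<alpha>) = Dom C (right \<alpha>) \<and> Cod C (left \<alpha>) = Cod C (right \<alpha>)}"
  "Src (indiscrete C) = left" "Tgt (indiscrete C) = right"
  "VIdt (indiscrete C) f = pair f f" "VCmp (indiscrete C) \<beta> \<alpha> = pair (left \<alpha>) (right \<beta>)"
  "HCmp (indiscrete C) \<beta> \<alpha> = pair (Cmp C (left \<beta>) (left \<alpha>)) (Cmp C (right \<beta>) (right \<alpha>))"
  by (simp_all add: indiscrete_def)

lemma truncate_indiscrete [simp]: "cat.truncate (indiscrete C) = C"
  by (simp add: indiscrete_def cat.truncate_def)

lemma indiscrete_cell_unique:
  assumes "\<alpha> \<in> Cell (indiscrete C)" "\<beta> \<in> Cell (indiscrete C)"
    and "Src (indiscrete C) \<alpha> = Src (indiscrete C) \<beta>" "Tgt (indiscrete C) \<alpha> = Tgt (indiscrete C) \<beta>"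
  shows "\<alpha> = \<beta>"
proof -
  have "\<alpha> = pair (left \<alpha>) (right \<alpha>)" "pair (left \<beta>) (right \<beta>) = \<beta>"
    using assms(1,2) by simp_all
  then show ?thesis using assms(3,4) by simp
qed

lemma category_indiscrete: "category C \<Longrightarrow> category (indiscrete C)"
  using category_truncate[of "indiscrete C"] by simp

lemma two_category_indiscrete:
  assumes "category C"
  shows "two_category (indiscrete C)"
proof -
  interpret C: category C by fact
  \<comment> \<open>the unit laws, usable when the object is only provably equal to the (co)domain\<close>
  have idt: "Cmp C (Idt C y) f = f" if "f \<in> Arr C" "Cod C f = y" for f y
    using that C.cmp_idt_left by blast
  have idt': "Cmp C f (Idt C y) = f" if "f \<in> Arr C" "Dom C f = y" for f y
    using that C.cmp_idt_right by blast
  interpret I: category "indiscrete C" by (rule category_indiscrete) fact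
  show ?thesis
    by unfold_locales (auto simp: C.dom_obj C.cod_obj C.idt_arr C.dom_idt C.cod_idt C.cmp_arr
        C.dom_cmp C.cod_cmp C.cmp_idt_left C.cmp_idt_right C.cmp_assoc idt idt')
qed

text \<open>
  Applied both to functors between indiscrete 2-categories and to the functor from one of
  them to the terminal 2-category.
\<close>

lemma fully_faithful_on_cells_indiscrete:
  assumes F: "two_functor (indiscrete C) D F"
    and D: "\<And>\<alpha> \<beta>. \<lbrakk>\<alpha> \<in> Cell D; \<beta> \<in> Cell D; Src D \<alpha> = Src D \<beta>; Tgt D \<alpha> = Tgt D \<beta>\<rbrakk> \<Longrightarrow> \<alpha> = \<beta>"
  shows "fully_faithful_on_cells (indiscrete C) D F"
  unfolding fully_faithful_on_cells_def
proof (intro ballI impI)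
  interpret F: two_functor "indiscrete C" D F by fact
  fix f g \<beta>
  assume f: "f \<in> Arr (indiscrete C)" "g \<in> Arr (indiscrete C)" and \<beta>: "\<beta> \<in> Cell D"
    and fg: "Dom (indiscrete C) f = Dom (indiscrete C) g \<and> Cod (indiscrete C) f = Cod (indiscrete C) g \<and>
      Src D \<beta> = FArr F f \<and> Tgt D \<beta> = FArr F g"
  have c: "pair f g \<in> Cell (indiscrete C)" using f fg by auto
  then have "FCell F (pair f g) = \<beta>"
    by (intro D[OF F.map_cell[OF c] \<beta>]) (simp_all add: F.map_src[OF c] F.map_tgt[OF c] fg)
  with c show "\<exists>!\<alpha>. \<alpha> \<in> Cell (indiscrete C) \<and> Src (indiscrete C) \<alpha> = f \<and>
      Tgt (indiscrete C) \<alpha> = g \<and> FCell F \<alpha> = \<beta>"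
    by (intro ex1I[of _ "pair f g"]) auto
qed

text \<open>
  All 2-cells of the target are determined by their boundary, so the values on 2-cells and the
  interchangers are the only ones with the boundaries that the axioms prescribe.
\<close>

definition indiscrete_bifunctor :: "'u cat \<Rightarrow> 'u cat \<Rightarrow> 'u cat \<Rightarrow> 'u bifunc \<Rightarrow> 'u gbifunc" where
  "indiscrete_bifunctor A B C T = \<lparr>BObj = BObj T, BL = BL T, BR = BR T,
     BL2 = (\<lambda>\<alpha> y. pair (BL T (left \<alpha>) y) (BL T (right \<alpha>) y)),
     BR2 = (\<lambda>x \<beta>. pair (BR T x (left \<beta>)) (BR T x (right \<beta>))),
     Gam = (\<lambda>f g. pair (Cmp C (BL T f (Cod B g)) (BR T (Dom A f) g))
       (Cmp C (BR T (Cod A f) g) (BL T f (Dom B g))))\<rparr>"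

lemma indiscrete_bifunctor_sel [simp]:
  "BObj (indiscrete_bifunctor A B C T) = BObj T"
  "BL (indiscrete_bifunctor A B C T) = BL T" "BR (indiscrete_bifunctor A B C T) = BR T"
  "BL2 (indiscrete_bifunctor A B C T) \<alpha> y = pair (BL T (left \<alpha>) y) (BL T (right \<alpha>) y)"
  "BR2 (indiscrete_bifunctor A B C T) x \<beta> = pair (BR T x (left \<beta>)) (BR T x (right \<beta>))"
  "Gam (indiscrete_bifunctor A B C T) f g = pair (Cmp C (BL T f (Cod B g)) (BR T (Dom A f) g))
     (Cmp C (BR T (Cod A f) g) (BL T f (Dom B g)))"
  by (simp_all add: indiscrete_bifunctor_def)

lemma two_functor_indiscrete:
  assumes "cat_functor C D F"
  shows "two_functor (indiscrete C) (indiscrete D)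
    \<lparr>FObj = FObj F, FArr = FArr F, FCell = (\<lambda>\<alpha>. pair (FArr F (left \<alpha>)) (FArr F (right \<alpha>)))\<rparr>"
    (is "two_functor _ _ ?F")
proof -
  interpret F: cat_functor C D F by fact
  show ?thesis
  proof (rule two_functorI)
    show "cat_functor (indiscrete C) (indiscrete D) ?F"
      using assms by (simp add: cat_functor_def cat_functor_axioms_def category_indiscrete)
  qed (auto simp: two_category_indiscrete F.source.category_axioms F.target.category_axioms
      F.map_arr F.map_dom F.map_cod F.map_cmp)
qed

text \<open>
  Equality of 2-cells in an indiscrete 2-category is equality of boundaries. The axioms on
  interchangers therefore reduce to associativity and functoriality in each variable.
\<close>

lemma gray_bifunctor_indiscrete:
  assumes "funny_functor A B C T"
  shows "gray_bifunctor (indiscrete A) (indiscrete B) (indiscrete C) (indiscrete_bifunctor A B C T)"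
proof -
  interpret T: funny_functor A B C T by fact
  note left = cat_functor.map_obj[OF T.left, simplified] cat_functor.map_arr[OF T.left, simplified]
    cat_functor.map_dom[OF T.left, simplified] cat_functor.map_cod[OF T.left, simplified]
    cat_functor.map_idt[OF T.left, simplified] cat_functor.map_cmp[OF T.left, simplified]
  note right = cat_functor.map_obj[OF T.right, simplified] cat_functor.map_arr[OF T.right, simplified]
    cat_functor.map_dom[OF T.right, simplified] cat_functor.map_cod[OF T.right, simplified]
    cat_functor.map_idt[OF T.right, simplified] cat_functor.map_cmp[OF T.right, simplified]
  \<comment> \<open>the unit laws, usable when the object is only provably equal to the (co)domain\<close>
  have idt: "Cmp C (Idt C y) f = f" if "f \<in> Arr C" "Cod C f = y" for f y
    using that T.C.cmp_idt_left by blast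
  have idt': "Cmp C f (Idt C y) = f" if "f \<in> Arr C" "Dom C f = y" for f y
    using that T.C.cmp_idt_right by blast
  note simps = left right idt idt' T.C.cmp_arr T.C.dom_cmp T.C.cod_cmp T.A.dom_obj T.A.cod_obj
    T.B.dom_obj T.B.cod_obj T.A.idt_arr T.A.dom_idt T.A.cod_idt T.B.idt_arr T.B.dom_idt T.B.cod_idt
    T.A.cmp_arr T.A.dom_cmp T.A.cod_cmp T.B.cmp_arr T.B.dom_cmp T.B.cod_cmp T.C.cmp_assoc
  show ?thesis
  proof (intro gray_bifunctor.intro gray_bifunctor_axioms.intro)
    fix x assume "x \<in> Obj (indiscrete A)"
    then show "two_functor (indiscrete B) (indiscrete C) \<lparr>FObj = BObj (indiscrete_bifunctor A B C T) x,
        FArr = BR (indiscrete_bifunctor A B C T) x, FCell = BR2 (indiscrete_bifunctor A B C T) x\<rparr>"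
      using two_functor_indiscrete[OF T.right[of x]] by (simp add: indiscrete_bifunctor_def)
  next
    fix y assume "y \<in> Obj (indiscrete B)"
    then show "two_functor (indiscrete A) (indiscrete C)
        \<lparr>FObj = (\<lambda>x. BObj (indiscrete_bifunctor A B C T) x y),
        FArr = (\<lambda>f. BL (indiscrete_bifunctor A B C T) f y),
        FCell = (\<lambda>\<alpha>. BL2 (indiscrete_bifunctor A B C T) \<alpha> y)\<rparr>"
      using two_functor_indiscrete[OF T.left[of y]] by simp
  next
    fix f g
    assume "f \<in> Arr (indiscrete A)" "g \<in> Arr (indiscrete B)"
    then show "\<exists>\<delta>\<in>Cell (indiscrete C).
        Src (indiscrete C) \<delta> = Tgt (indiscrete C) (Gam (indiscrete_bifunctor A B C T) f g) \<and>
        Tgt (indiscrete C) \<delta> = Src (indiscrete C) (Gam (indiscrete_bifunctor A B C T) f g) \<and>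
        VCmp (indiscrete C) \<delta> (Gam (indiscrete_bifunctor A B C T) f g) =
          VIdt (indiscrete C) (Src (indiscrete C) (Gam (indiscrete_bifunctor A B C T) f g)) \<and>
        VCmp (indiscrete C) (Gam (indiscrete_bifunctor A B C T) f g) \<delta> =
          VIdt (indiscrete C) (Tgt (indiscrete C) (Gam (indiscrete_bifunctor A B C T) f g))"
      \<comment> \<open>the inverse of an interchanger is the cell with source and target exchanged\<close>
      by (intro bexI[of _ "pair (Cmp C (BR T (Cod A f) g) (BL T f (Dom B g)))
        (Cmp C (BL T f (Cod B g)) (BR T (Dom A f) g))"]) (simp_all add: simps)
  qed (simp_all add: two_category_indiscrete T.A.category_axioms T.B.category_axioms
      T.C.category_axioms simps)
qed

text \<open>
  The right adjoint of \<open>U_star\<close> on objects.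
\<close>

definition indiscrete_gray :: "'u sesqui \<Rightarrow> 'u gray" where
  "indiscrete_gray S = \<lparr>EOb = EOb S, EHom = (\<lambda>a b. indiscrete (EHom S a b)), EUnit = EUnit S,
     EComp = (\<lambda>a b c. indiscrete_bifunctor (EHom S b c) (EHom S a b) (EHom S a c) (EComp S a b c))\<rparr>"

lemma indiscrete_gray_sel [simp]:
  "EOb (indiscrete_gray S) = EOb S" "EHom (indiscrete_gray S) a b = indiscrete (EHom S a b)"
  "EUnit (indiscrete_gray S) = EUnit S"
  "EComp (indiscrete_gray S) a b c =
    indiscrete_bifunctor (EHom S b c) (EHom S a b) (EHom S a c) (EComp S a b c)"
  by (simp_all add: indiscrete_gray_def)

lemma U_star_indiscrete_gray [simp]: "U_star (indiscrete_gray S) = S"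
  by (auto simp: U_star_def indiscrete_gray_def indiscrete_bifunctor_def bifunc.truncate_def
      intro!: enriched.equality ext bifunc.equality)

lemma gray_category_indiscrete:
  assumes "sesquicategory S"
  shows "gray_category (indiscrete_gray S)"
proof -
  interpret S: sesquicategory S by fact
  have obj: "BObj (EComp S a b c) g f \<in> Obj (EHom S a c)"
    if "a \<in> EOb S" "b \<in> EOb S" "c \<in> EOb S" "g \<in> Obj (EHom S b c)" "f \<in> Obj (EHom S a b)" for a b c f g
    using cat_functor.map_obj[OF funny_functor.right[OF S.comp_functor[of a b c], of g], of f] that by simp
  have bl: "BL (EComp S a b c) g f \<in> Arr (EHom S a c) \<and>
      Dom (EHom S a c) (BL (EComp S a b c) g f) = BObj (EComp S a b c) (Dom (EHom S b c) g) f \<and>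
      Cod (EHom S a c) (BL (EComp S a b c) g f) = BObj (EComp S a b c) (Cod (EHom S b c) g) f"
    if "a \<in> EOb S" "b \<in> EOb S" "c \<in> EOb S" "g \<in> Arr (EHom S b c)" "f \<in> Obj (EHom S a b)" for a b c f g
  proof -
    interpret L: cat_functor "EHom S b c" "EHom S a c" "\<lparr>FObj = (\<lambda>x. BObj (EComp S a b c) x f),
        FArr = (\<lambda>g. BL (EComp S a b c) g f)\<rparr>"
      by (rule funny_functor.left[OF S.comp_functor]) (use that in simp_all)
    show ?thesis using L.map_arr[of g] L.map_dom[of g] L.map_cod[of g] that by simp
  qed
  have br: "BR (EComp S a b c) g f \<in> Arr (EHom S a c) \<and>
      Dom (EHom S a c) (BR (EComp S a b c) g f) = BObj (EComp S a b c) g (Dom (EHom S a b) f) \<and>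
      Cod (EHom S a c) (BR (EComp S a b c) g f) = BObj (EComp S a b c) g (Cod (EHom S a b) f)"
    if "a \<in> EOb S" "b \<in> EOb S" "c \<in> EOb S" "g \<in> Obj (EHom S b c)" "f \<in> Arr (EHom S a b)" for a b c f g
  proof -
    interpret R: cat_functor "EHom S a b" "EHom S a c" "\<lparr>FObj = BObj (EComp S a b c) g,
        FArr = BR (EComp S a b c) g\<rparr>"
      by (rule funny_functor.right[OF S.comp_functor]) (use that in simp_all)
    show ?thesis using R.map_arr[of f] R.map_dom[of f] R.map_cod[of f] that by simp
  qed
  have bl_cmp: "BL (EComp S a b c) (Cmp (EHom S b c) h g) f =
      Cmp (EHom S a c) (BL (EComp S a b c) h f) (BL (EComp S a b c) g f)"
    if "a \<in> EOb S" "b \<in> EOb S" "c \<in> EOb S" "g \<in> Arr (EHom S b c)" "h \<in> Arr (EHom S b c)"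
      "Cod (EHom S b c) g = Dom (EHom S b c) h" "f \<in> Obj (EHom S a b)" for a b c f g h
    using cat_functor.map_cmp[OF funny_functor.left[OF S.comp_functor[of a b c], of f], of g h] that
    by simp
  have br_cmp: "BR (EComp S a b c) f (Cmp (EHom S a b) h g) =
      Cmp (EHom S a c) (BR (EComp S a b c) f h) (BR (EComp S a b c) f g)"
    if "a \<in> EOb S" "b \<in> EOb S" "c \<in> EOb S" "g \<in> Arr (EHom S a b)" "h \<in> Arr (EHom S a b)"
      "Cod (EHom S a b) g = Dom (EHom S a b) h" "f \<in> Obj (EHom S b c)" for a b c f g h
    using cat_functor.map_cmp[OF funny_functor.right[OF S.comp_functor[of a b c], of f], of g h] that
    by simp
  note hom = category.dom_obj[OF S.hom_category] category.cod_obj[OF S.hom_category]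
  show ?thesis
    by (intro gray_category.intro gray_category_axioms.intro)
      (simp_all add: S.sesquicategory_axioms two_category_indiscrete S.hom_category
        gray_bifunctor_indiscrete S.comp_functor S.assoc_arr_left S.assoc_arr_mid
        S.assoc_arr_right S.unit_left_arr S.unit_right_arr obj bl br bl_cmp br_cmp hom)
qed

lemma locally_fully_faithful_on_cells_indiscrete:
  assumes P: "gray_functor (indiscrete_gray S) Y P"
    and Y: "\<And>a b \<alpha> \<beta>. \<lbrakk>\<alpha> \<in> Cell (EHom Y a b); \<beta> \<in> Cell (EHom Y a b);
      Src (EHom Y a b) \<alpha> = Src (EHom Y a b) \<beta>; Tgt (EHom Y a b) \<alpha> = Tgt (EHom Y a b) \<beta>\<rbrakk> \<Longrightarrow> \<alpha> = \<beta>"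
  shows "locally_fully_faithful_on_cells (indiscrete_gray S) Y P"
  unfolding locally_fully_faithful_on_cells_def
proof (intro ballI)
  fix a b assume "a \<in> EOb (indiscrete_gray S)" "b \<in> EOb (indiscrete_gray S)"
  then have "two_functor (indiscrete (EHom S a b)) (EHom Y (EFOb P a) (EFOb P b)) (EFHom P a b)"
    using gray_functor.map_two_hom[OF P, of a b] by simp
  from fully_faithful_on_cells_indiscrete[OF this] Y
  show "fully_faithful_on_cells (EHom (indiscrete_gray S) a b)
      (EHom Y (EFOb P a) (EFOb P b)) (EFHom P a b)" by simp
qed

lemma indiscrete_gray_to_terminal:
  assumes "sesquicategory S"
  shows "gray_functor (indiscrete_gray S) terminal_gray to_terminal_gray"
    and "locally_fully_faithful_on_cells (indiscrete_gray S) terminal_gray to_terminal_gray"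
proof -
  show "gray_functor (indiscrete_gray S) terminal_gray to_terminal_gray"
    by (rule gray_functor_to_terminal[OF gray_category_indiscrete[OF assms]])
  then show "locally_fully_faithful_on_cells (indiscrete_gray S) terminal_gray to_terminal_gray"
    by (rule locally_fully_faithful_on_cells_indiscrete) (rule terminal_gray_cell_unique)
qed

text \<open>
  Transposition: the functor from \<open>indiscrete_gray S\<close> to the terminal Gray-category is bijective on
  3-cells with given boundary, so any sesquifunctor into \<open>S\<close> lifts along it.
\<close>

lemma gray_functor_to_indiscrete:
  assumes B: "gray_category B" and G: "sesquifunctor (U_star B) S G"
  obtains G' where "gray_functor B (indiscrete_gray S) G'" "U_star_fun G' = G"
proof -
  have S: "sesquicategory S" using G by (rule sesquifunctor.axioms)
  show thesis
    by (rule gray_functor_lift[OF indiscrete_gray_to_terminal[OF S] gray_functor_to_terminal[OF B],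
          of G])
      (use G that in \<open>simp_all add: eq_on_sesqui_def eq_on_cat_def to_terminal_gray_def\<close>)
qed

lemma eq_on_gray_to_indiscrete:
  assumes H: "gray_functor A (indiscrete_gray S) H" and H': "gray_functor A (indiscrete_gray S) H'"
    and eq: "eq_on_sesqui (U_star A) (U_star_fun H) (U_star_fun H')"
  shows "eq_on_gray A H H'"
proof -
  have S: "sesquicategory S"
    using gray_functor.axioms(2)[OF H] gray_category.axioms(1) by fastforce
  show ?thesis
    by (rule eq_on_gray_if_locally_fully_faithful[OF indiscrete_gray_to_terminal[OF S] H H' eq])
      (simp add: to_terminal_gray_def)
qed

text \<open>
  A surjection transposes to a functor that satisfies the first condition of
  \<open>gray_trivial_fibration_iff\<close> by assumption, and the second because both of its ends are
  indiscrete.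
\<close>

lemma gray_trivial_fibration_indiscrete:
  assumes P: "sesqui_surjective S T P"
  obtains P' where "gray_trivial_fibration (indiscrete_gray S) (indiscrete_gray T) P'"
    "U_star_fun P' = P"
proof -
  have f: "sesquifunctor S T P" using P by (simp add: sesqui_surjective_def)
  then have "gray_category (indiscrete_gray S)"
    by (intro gray_category_indiscrete) (rule sesquifunctor.axioms)
  with f obtain P' where P': "gray_functor (indiscrete_gray S) (indiscrete_gray T) P'" "U_star_fun P' = P"
    by (metis U_star_indiscrete_gray gray_functor_to_indiscrete)
  have "locally_fully_faithful_on_cells (indiscrete_gray S) (indiscrete_gray T) P'"
    by (rule locally_fully_faithful_on_cells_indiscrete[OF P'(1)])
      (simp only: indiscrete_gray_sel(2), rule indiscrete_cell_unique)
  with P P' that show thesis by (simp add: gray_trivial_fibration_iff)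
qed

end

lemma pairing_exists:
  assumes "infinite (UNIV :: 'u set)"
  obtains pair :: "'u \<Rightarrow> 'u \<Rightarrow> 'u" and left right where "pairing pair left right"
proof -
  obtain f :: "'u \<times> 'u \<Rightarrow> 'u" where "bij_betw f (UNIV \<times> UNIV) UNIV"
    using card_of_Times_same_infinite[OF assms] card_of_ordIso by blast
  then have "inj f" by (simp add: bij_betw_def)
  then have "pairing (curry f) (fst \<circ> inv f) (snd \<circ> inv f)"
    by unfold_locales simp_all
  then show thesis by (rule that)
qed

section \<open>Cofibrations and surjections\<close>

context pairing
begin

text \<open>
  The lifting problem is transposed along the adjunction, solved there, and the underlying
  sesquifunctor of the solution is taken.
\<close>

lemma sesqui_llp_if_gray_cofibration:
  fixes A B :: "'u gray"
  assumes F: "gray_cofibration A B F"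
  shows "sesqui_llp_surjective (U_star A) (U_star B) (U_star_fun F)"
  unfolding sesqui_llp_surjective_def
proof (intro allI impI, elim conjE)
  fix S T P G K
  assume P: "sesqui_surjective S T P" and G: "sesquifunctor (U_star A) S G"
    and K: "sesquifunctor (U_star B) T K"
    and eq: "eq_on_sesqui (U_star A) (sesqui_comp P G) (sesqui_comp K (U_star_fun F))"
  have F': "gray_functor A B F" using F by (simp add: gray_cofibration_def)
  obtain P' where P': "gray_trivial_fibration (indiscrete_gray S) (indiscrete_gray T) P'"
    "U_star_fun P' = P" by (rule gray_trivial_fibration_indiscrete[OF P])
  obtain G' where G': "gray_functor A (indiscrete_gray S) G'" "U_star_fun G' = G"
    by (rule gray_functor_to_indiscrete[OF gray_functor.axioms(1)[OF F'] G])
  obtain K' where K': "gray_functor B (indiscrete_gray T) K'" "U_star_fun K' = K"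
    by (rule gray_functor_to_indiscrete[OF gray_functor.axioms(2)[OF F'] K])
  have "gray_functor (indiscrete_gray S) (indiscrete_gray T) P'"
    using P'(1) by (simp add: gray_trivial_fibration_def)
  then have "eq_on_gray A (gray_comp P' G') (gray_comp K' F)"
    by (rule eq_on_gray_to_indiscrete[OF gray_functor_comp[OF G'(1)] gray_functor_comp[OF F' K'(1)]])
      (simp add: U_star_fun_comp P' G' K' eq)
  with F P'(1) G'(1) K'(1) obtain L where "gray_functor B (indiscrete_gray S) L"
    "eq_on_gray A (gray_comp L F) G'" "eq_on_gray B (gray_comp P' L) K'"
    unfolding gray_cofibration_def by blast
  then show "\<exists>L. sesquifunctor (U_star B) S L \<and> eq_on_sesqui (U_star A) (sesqui_comp L (U_star_fun F)) G \<and>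
      eq_on_sesqui (U_star B) (sesqui_comp P L) K"
    using gray_functor.axioms(3)[of B "indiscrete_gray S" L] eq_on_grayD(1)[of A "gray_comp L F" G']
      eq_on_grayD(1)[of B "gray_comp P' L" K']
    by (intro exI[of _ "U_star_fun L"]) (simp add: U_star_fun_comp P' G' K')
qed

end

text \<open>
  The underlying problem is solved first, and its solution extends to 3-cells in a unique way; the
  extension makes the upper triangle commute on 3-cells by uniqueness.
\<close>

lemma gray_cofibration_if_sesqui_llp:
  assumes F: "gray_functor A B F"
    and llp: "sesqui_llp_surjective (U_star A) (U_star B) (U_star_fun F)"
  shows "gray_cofibration A B F"
  unfolding gray_cofibration_def
proof (intro conjI allI impI F, elim conjE)
  fix X Y P G K
  assume P: "gray_trivial_fibration X Y P" and G: "gray_functor A X G" and K: "gray_functor B Y K"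
    and eq: "eq_on_gray A (gray_comp P G) (gray_comp K F)"
  have P': "gray_functor X Y P" "sesqui_surjective (U_star X) (U_star Y) (U_star_fun P)"
    "locally_fully_faithful_on_cells X Y P"
    using P by (simp_all add: gray_trivial_fibration_iff)
  obtain L\<^sub>0 where L\<^sub>0: "sesquifunctor (U_star B) (U_star X) L\<^sub>0"
    "eq_on_sesqui (U_star A) (sesqui_comp L\<^sub>0 (U_star_fun F)) (U_star_fun G)"
    "eq_on_sesqui (U_star B) (sesqui_comp (U_star_fun P) L\<^sub>0) (U_star_fun K)"
    using llp[unfolded sesqui_llp_surjective_def, rule_format, OF conjI[OF P'(2)]]
      gray_functor.axioms(3)[OF G] gray_functor.axioms(3)[OF K] eq_on_grayD(1)[OF eq]
    unfolding U_star_fun_comp by blast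
  obtain L where L: "gray_functor B X L" "U_star_fun L = L\<^sub>0" "eq_on_gray B (gray_comp P L) K"
    by (rule gray_functor_lift[OF P'(1,3) K L\<^sub>0(1,3)])
  interpret F: gray_functor A B F by fact
  have "eq_on_gray A (gray_comp L F) G"
  proof (rule eq_on_gray_if_locally_fully_faithful[OF P'(1,3) gray_functor_comp[OF F L(1)] G])
    show "eq_on_sesqui (U_star A) (U_star_fun (gray_comp L F)) (U_star_fun G)"
      using L\<^sub>0(2) by (simp add: U_star_fun_comp L)
    fix a b \<phi> assume a: "a \<in> EOb A" "b \<in> EOb A" "\<phi> \<in> Cell (EHom A a b)"
    show "FCell (EFHom (gray_comp P (gray_comp L F)) a b) \<phi> = FCell (EFHom (gray_comp P G) a b) \<phi>"
      using eq_on_grayD(2)[OF eq a] F.map_ob[of a] F.map_ob[of b]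
        two_functor.map_cell[OF F.map_two_hom[OF a(1,2)] a(3)] a
        eq_on_grayD(2)[OF L(3), of "EFOb F a" "EFOb F b" "FCell (EFHom F a b) \<phi>"]
      by simp
  qed
  with L show "\<exists>L. gray_functor B X L \<and> eq_on_gray A (gray_comp L F) G \<and> eq_on_gray B (gray_comp P L) K"
    by blast
qed

text \<open>
  From the initial sesquicategory there is a functor to anything, and any two such functors agree, so
  the upper edge of a lifting problem can be chosen freely and imposes nothing.
\<close>

lemma sesqui_llp_initial_iff_projective:
  assumes "sesquicategory C"
  shows "sesqui_llp_surjective (U_star gray_initial) C F \<longleftrightarrow> sesqui_projective C"
proof -
  have "sesquifunctor (U_star gray_initial) S G" if "sesquicategory S" for S :: "'a sesqui" and G
  proof -
    interpret S: sesquicategory S by fact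
    interpret I: gray_category "gray_initial :: 'a gray" by (rule gray_category_initial)
    show ?thesis by unfold_locales (simp_all add: gray_initial_def)
  qed
  moreover have "sesquicategory S" if "sesqui_surjective S T P" for S T :: "'a sesqui" and P
    using that sesquifunctor.axioms(1) by (auto simp: sesqui_surjective_def)
  moreover have "eq_on_sesqui (U_star gray_initial) G H" for G H :: "'a sesqui_fun"
    by (simp add: eq_on_sesqui_def gray_initial_def)
  ultimately show ?thesis
    using assms unfolding sesqui_llp_surjective_def sesqui_projective_def by blast
qed

theorem proposition9p1:
  assumes "infinite (UNIV :: 'u set)"
  shows "(\<forall>(A :: 'u gray) B F. gray_functor A B F \<longrightarrow>
           (gray_cofibration A B F \<longleftrightarrow> sesqui_llp_surjective (U_star A) (U_star B) (U_star_fun F)))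
       \<and> (\<forall>A :: 'u gray. gray_category A \<longrightarrow>
           (gray_cofibrant A \<longleftrightarrow> sesqui_projective (U_star A)))"
proof -
  obtain pair :: "'u \<Rightarrow> 'u \<Rightarrow> 'u" and left right where "pairing pair left right"
    using assms by (rule pairing_exists)
  then interpret pairing pair left right .
  have cof: "gray_cofibration A B F \<longleftrightarrow> sesqui_llp_surjective (U_star A) (U_star B) (U_star_fun F)"
    if "gray_functor A B F" for A B :: "'u gray" and F
    using that gray_cofibration_if_sesqui_llp sesqui_llp_if_gray_cofibration by blast
  have "gray_cofibrant A \<longleftrightarrow> sesqui_projective (U_star A)" if A: "gray_category A" for A :: "'u gray"
    using sesqui_llp_initial_iff_projective[OF gray_category.axioms(1)[OF A]]
      gray_functor_from_initial[OF A] cof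
    unfolding gray_cofibrant_def by blast
  with cof show ?thesis by blast
qed

end
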